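(* Let $s_1,s_2\in\overline{\mathbf R_\flat}$ be such that $s_1<\frac12$ and $s_2\le\frac12$. Then the mappings $a\mapsto\operatorname{Op}_{\mathfrak V}^{\mathrm{aw}}(a)$, $$\widehat{\mathcal C}_{s_1}(\mathbf C^{2d})\to\operatorname{Op}_{\mathfrak V}(\widehat{\mathcal C}_{s_1}(\mathbf C^{2d})),\qquad \widehat{\mathcal C}_{s_1}^\star(\mathbf C^{2d})\to\operatorname{Op}_{\mathfrak V}(\widehat{\mathcal C}_{s_1}^\star(\mathbf C^{2d})),$$ $$\widehat{\mathcal C}_{0,s_2}(\mathbf C^{2d})\to\operatorname{Op}_{\mathfrak V}(\widehat{\mathcal C}_{0,s_2}(\mathbf C^{2d})),\qquad \widehat{\mathcal C}_{0,s_2}^\star(\mathbf C^{2d})\to\operatorname{Op}_{\mathfrak V}(\widehat{\mathcal C}_{0,s_2}^\star(\mathbf C^{2d})),$$ are isomorphisms (linear bijections), where $\operatorname{Op}_{\mathfrak V}(X)=\{\operatorname{Op}_{\mathfrak V}(a):a\in X\}$.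
   Context: **Indices and weights.** $\mathbf N=\{0,1,2,\dots\}$. $\overline{\mathbf R_\flat}=[0,\infty)\cup\{\flat_\sigma:\sigma>0\}$, where the $\flat_\sigma$ are formal symbols, ordered so that $x_1<\flat_{\sigma_1}<\flat_{\sigma_2}<x_2$ whenever $x_1<\frac12\le x_2$ and $\sigma_1<\sigma_2$. For $r>0$ and $\alpha\in\mathbf N^d$: $\vartheta_{r,s}(\alpha)=e^{r|\alpha|^{1/(2s)}}$ if $s\in(0,\infty)$; $\vartheta_{r,s}(\alpha)=r^{|\alpha|}(\alpha!)^{1/(2\sigma)}$ if $s=\flat_\sigma$; $\vartheta_{r,0}(\alpha)=1$ if $|\alpha|\le r$ and $=\infty$ if $|\alpha|>r$. Conventions: $a/\infty=0$ for all $a\in(0,\infty]$, $\infty\cdot0=0$. For $\omega:\mathbf N^{2d}\to[0,\infty]$, $\ell_{[\omega]}$ is the set of $c:\mathbf N^{2d}\to\mathbf C$ with $\|c\,\omega\|_{\ell^p}<\infty$, with this (quasi-/semi-)norm, $p\in(0,\infty]$ fixed (the limit spaces below do not depend on $p$). **Spaces.** On $\mathbf N^{2d}=\mathbf N^d\times\mathbf N^d\ni(\alpha,\beta)$ put $\omega_{r_2,r_1}(\alpha,\beta)=\vartheta_{r_2,s}(\alpha)/\vartheta_{r_1,s}(\beta)$, $\omega^\star_{r_2,r_1}(\alpha,\beta)=\vartheta_{r_1,s}(\beta)/\vartheta_{r_2,s}(\alpha)$. With limits over positive parameters: $\ell_{\mathcal C,s}=\operatorname{ind\,lim}_{r_2}\operatorname{proj\,lim}_{r_1}\ell_{[\omega_{r_2,r_1}]}$,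 $\ell_{\mathcal C,0,s}=\operatorname{ind\,lim}_{r_1}\operatorname{proj\,lim}_{r_2}\ell_{[\omega_{r_2,r_1}]}$, $\ell_{\mathcal C,s}^\star=\operatorname{ind\,lim}_{r_1}\operatorname{proj\,lim}_{r_2}\ell_{[\omega^\star_{r_2,r_1}]}$, $\ell_{\mathcal C,0,s}^\star=\operatorname{ind\,lim}_{r_2}\operatorname{proj\,lim}_{r_1}\ell_{[\omega^\star_{r_2,r_1}]}$; $\ell_{\mathcal C,0,0}=\ell_{\mathcal C,0,0}^\star=\{0\}$. As sets, projective/inductive limits are intersections/unions. With $e_\alpha(z)=z^\alpha/\sqrt{\alpha!}$, $\widehat{\mathcal C}_s,\widehat{\mathcal C}_{0,s},\widehat{\mathcal C}_s^\star,\widehat{\mathcal C}_{0,s}^\star$ are the spaces of formal series $a(z,w)=\sum_{\alpha,\beta}c(a;\alpha,\beta)e_\alpha(z)e_\beta(\overline w)$, $z,w\in\mathbf C^d$, with coefficients in the corresponding sequence space. $\mathcal A_0(\mathbf C^d)$ is the space of polynomials $F=\sum_\alpha c(F;\alpha)e_\alpha$. **Wick operators.** For a formal series $a(z,w)=\sum_{\alpha,\beta\in\mathbf N^d}c(a;\alpha,\beta)e_\alpha(z)e_\beta(\overline w)$, let $K(z,w)=e^{(z,w)}a(z,w)$ (product of formal power series in $(z,\overline w)$, $(z,w)=\sum_jz_j\overline{w_j}$), with coefficients $c(K;\alpha,\beta)$ given by $K(z,w)=\sum_{\alpha,\beta\in\mathbf N^d}c(K;\alpha,\beta)e_\alpha(z)e_\beta(\overline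 w)$. The Wick operator is defined on $F\in\mathcal A_0(\mathbf C^d)$ by $\operatorname{Op}_{\mathfrak V}(a)F=\sum_\alpha\big(\sum_\beta c(K;\alpha,\beta)c(F;\beta)\big)e_\alpha$ (a formal power series); when the integral makes sense, $\operatorname{Op}_{\mathfrak V}(a)F(z)=\pi^{-d}\int_{\mathbf C^d}a(z,w)F(w)e^{(z-w,w)}\,d\lambda(w)$. **Anti-Wick operators.** For $a$ with finitely many non-zero coefficients, $\operatorname{Op}_{\mathfrak V}^{\mathrm{aw}}(a)F(z)=\pi^{-d}\int_{\mathbf C^d}a(w,w)F(w)e^{(z-w,w)}\,d\lambda(w)$, and then $\operatorname{Op}_{\mathfrak V}^{\mathrm{aw}}(a)=\operatorname{Op}_{\mathfrak V}(\mathcal T_1^*a)$, where $c(\mathcal T_1^*a;\alpha,\beta)=\sum_{\gamma\in\mathbf N^d}\big(\binom{\alpha+\gamma}\gamma\binom{\beta+\gamma}\gamma\big)^{1/2}c(a;\alpha+\gamma,\beta+\gamma)$. For $a$ in $\widehat{\mathcal C}_s(\mathbf C^{2d})$ or $\widehat{\mathcal C}_s^\star(\mathbf C^{2d})$ with $s<\frac12$, or in $\widehat{\mathcal C}_{0,s}(\mathbf C^{2d})$ or $\widehat{\mathcal C}_{0,s}^\star(\mathbf C^{2d})$ with $s\le\frac12$, the series defining $c(\mathcal T_1^*a;\alpha,\beta)$ also converges, and $\operatorname{Op}_{\mathfrak V}^{\mathrm{aw}}(a)$ is defined as $\operatorname{Op}_{\mathfrak V}(\mathcal T_1^*a)$.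 *)

theory Defs
  imports "HOL-Analysis.Analysis" "HOL-Library.Function_Algebras" "HOL-Library.Poly_Mapping"
begin

section \<open>The index set of regularity parameters\<close>

datatype rflat = Reg real | Flat real

instantiation rflat :: linorder
begin

fun less_eq_rflat :: "rflat \<Rightarrow> rflat \<Rightarrow> bool" where
  "less_eq_rflat (Reg x) (Reg y) \<longleftrightarrow> x \<le> y"
| "less_eq_rflat (Reg x) (Flat \<tau>) \<longleftrightarrow> x < 1/2"
| "less_eq_rflat (Flat \<sigma>) (Reg y) \<longleftrightarrow> 1/2 \<le> y"
| "less_eq_rflat (Flat \<sigma>) (Flat \<tau>) \<longleftrightarrow> \<sigma> \<le> \<tau>"

definition less_rflat :: "rflat \<Rightarrow> rflat \<Rightarrow> bool" where
  "less_rflat x y \<longleftrightarrow> x \<le> y \<and> \<not> y \<le> x"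

instance
proof
  fix x y z :: rflat
  show "x < y \<longleftrightarrow> x \<le> y \<and> \<not> y \<le> x" by (rule less_rflat_def)
  show "x \<le> x" by (cases x) auto
  show "x \<le> y \<Longrightarrow> y \<le> z \<Longrightarrow> x \<le> z" by (cases x; cases y; cases z) auto
  show "x \<le> y \<Longrightarrow> y \<le> x \<Longrightarrow> x = y" by (cases x; cases y) auto
  show "x \<le> y \<or> y \<le> x" by (cases x; cases y) auto
qed

end

text \<open>The type contains junk such as negative parameters; the actual index set is the
  following carrier.\<close>

definition Rflat :: "rflat set" where
  "Rflat = {Reg x |x. 0 \<le> x} \<union> {Flat \<sigma> |\<sigma>. 0 < \<sigma>}"


section \<open>Multi-indices and weights\<close>

definition mlen :: "nat ^ 'd \<Rightarrow> nat" where
  "mlen \<alpha> = (\<Sum>j\<in>UNIV. \<alpha> $ j)"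

definition mfact :: "nat ^ 'd \<Rightarrow> real" where
  "mfact \<alpha> = (\<Prod>j\<in>UNIV. fact (\<alpha> $ j))"

definition mbinom :: "nat ^ 'd \<Rightarrow> nat ^ 'd \<Rightarrow> real" where
  "mbinom \<alpha> \<beta> = (\<Prod>j\<in>UNIV. real ((\<alpha> $ j) choose (\<beta> $ j)))"

fun theta :: "real \<Rightarrow> rflat \<Rightarrow> nat ^ 'd \<Rightarrow> ennreal" where
  "theta r (Reg s) \<alpha> =
     (if s = 0 then (if real (mlen \<alpha>) \<le> r then 1 else \<infinity>)
      else ennreal (exp (r * real (mlen \<alpha>) powr (1 / (2 * s)))))"
| "theta r (Flat \<sigma>) \<alpha> = ennreal (r ^ mlen \<alpha> * mfact \<alpha> powr (1 / (2 * \<sigma>)))"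

text \<open>In \<open>ennreal\<close> one has \<open>a / \<infinity> = 0\<close> for every \<open>a\<close>, including \<open>\<infinity>\<close>,
  and \<open>\<infinity> * 0 = 0\<close>, which are the conventions wanted here.\<close>

definition omega :: "rflat \<Rightarrow> real \<Rightarrow> real \<Rightarrow> (nat ^ 'd) \<times> (nat ^ 'd) \<Rightarrow> ennreal" where
  "omega s r2 r1 = (\<lambda>(\<alpha>, \<beta>). theta r2 s \<alpha> / theta r1 s \<beta>)"

definition omega_star :: "rflat \<Rightarrow> real \<Rightarrow> real \<Rightarrow> (nat ^ 'd) \<times> (nat ^ 'd) \<Rightarrow> ennreal" where
  "omega_star s r2 r1 = (\<lambda>(\<alpha>, \<beta>). theta r1 s \<beta> / theta r2 s \<alpha>)"


section \<open>Weighted sequence spaces\<close>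

text \<open>Real powers of extended nonnegative reals, for exponents \<open>q > 0\<close>.\<close>

definition epowr :: "ennreal \<Rightarrow> real \<Rightarrow> ennreal" where
  "epowr x q = (if x = \<infinity> then \<infinity> else ennreal (enn2real x powr q))"

definition lp_norm :: "ennreal \<Rightarrow> ('i \<Rightarrow> ennreal) \<Rightarrow> ennreal" where
  "lp_norm p f =
     (if p = \<infinity> then (SUP i. f i)
      else epowr (\<Sum>\<^sub>\<infinity>i. epowr (f i) (enn2real p)) (1 / enn2real p))"

definition ell :: "ennreal \<Rightarrow> ('i \<Rightarrow> ennreal) \<Rightarrow> ('i \<Rightarrow> complex) set" where
  "ell p \<omega> = {c. lp_norm p (\<lambda>i. ennreal (cmod (c i)) * \<omega> i) < \<infinity>}"

definition ell_C :: "ennreal \<Rightarrow> rflat \<Rightarrow> ((nat ^ 'd) \<times> (nat ^ 'd) \<Rightarrow> complex) set" where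
  "ell_C p s = (\<Union>r2\<in>{0<..}. \<Inter>r1\<in>{0<..}. ell p (omega s r2 r1))"

definition ell_C0 :: "ennreal \<Rightarrow> rflat \<Rightarrow> ((nat ^ 'd) \<times> (nat ^ 'd) \<Rightarrow> complex) set" where
  "ell_C0 p s =
     (if s = Reg 0 then {0} else (\<Union>r1\<in>{0<..}. \<Inter>r2\<in>{0<..}. ell p (omega s r2 r1)))"

definition ell_C_star :: "ennreal \<Rightarrow> rflat \<Rightarrow> ((nat ^ 'd) \<times> (nat ^ 'd) \<Rightarrow> complex) set" where
  "ell_C_star p s = (\<Union>r1\<in>{0<..}. \<Inter>r2\<in>{0<..}. ell p (omega_star s r2 r1))"

definition ell_C0_star :: "ennreal \<Rightarrow> rflat \<Rightarrow> ((nat ^ 'd) \<times> (nat ^ 'd) \<Rightarrow> complex) set" where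
  "ell_C0_star p s =
     (if s = Reg 0 then {0} else (\<Union>r2\<in>{0<..}. \<Inter>r1\<in>{0<..}. ell p (omega_star s r2 r1)))"


section \<open>Formal power series\<close>

text \<open>A formal power series is given by its coefficients with respect to the monomials:
  \<open>a (\<alpha>, \<beta>)\<close> is the coefficient of \<open>z\<^sup>\<alpha> cnj w\<^sup>\<beta>\<close> in a series \<open>a(z,w)\<close>, and \<open>f \<alpha>\<close> that of
  \<open>z\<^sup>\<alpha>\<close> in a series \<open>f(z)\<close>. Note that \<open>*\<close> and \<open>^\<close> on these function types are
  the pointwise operations; the product of series is \<open>cauchy\<close>.\<close>

type_synonym 'd series1 = "nat ^ 'd \<Rightarrow> complex"
type_synonym 'd series2 = "(nat ^ 'd) \<times> (nat ^ 'd) \<Rightarrow> complex"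

definition cauchy :: "('i::comm_monoid_add \<Rightarrow> complex) \<Rightarrow> ('i \<Rightarrow> complex) \<Rightarrow> 'i \<Rightarrow> complex" where
  "cauchy f g \<kappa> = (\<Sum>(\<mu>, \<nu>)\<in>{(\<mu>, \<nu>). \<mu> + \<nu> = \<kappa>}. f \<mu> * g \<nu>)"

definition series_one :: "'i::comm_monoid_add \<Rightarrow> complex" where
  "series_one \<kappa> = (if \<kappa> = 0 then 1 else 0)"

definition series_power :: "('i::comm_monoid_add \<Rightarrow> complex) \<Rightarrow> nat \<Rightarrow> 'i \<Rightarrow> complex" where
  "series_power f n = (cauchy f ^^ n) series_one"

text \<open>For \<open>f\<close> without constant term, only finitely many \<open>n\<close> contribute to each coefficient.\<close>

definition series_exp :: "('i::comm_monoid_add \<Rightarrow> complex) \<Rightarrow> 'i \<Rightarrow> complex" where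
  "series_exp f \<kappa> = suminf (\<lambda>n. series_power f n \<kappa> / fact n)"

text \<open>The series of \<open>(z, w) = \<Sum>\<^sub>j z\<^sub>j cnj w\<^sub>j\<close>.\<close>

definition pairing :: "'d::finite series2" where
  "pairing \<kappa> = (\<Sum>j\<in>UNIV. if \<kappa> = (axis j 1, axis j 1) then 1 else 0)"

text \<open>Coefficients \<open>c(f; \<alpha>)\<close> and \<open>c(a; \<alpha>, \<beta>)\<close> with respect to \<open>e\<^sub>\<alpha>(z)\<close> and
  \<open>e\<^sub>\<alpha>(z) e\<^sub>\<beta>(cnj w)\<close>, where \<open>e\<^sub>\<alpha>(z) = z\<^sup>\<alpha> / sqrt (\<alpha>!)\<close>, and the series with
  prescribed such coefficients.\<close>

definition coef1 :: "'d::finite series1 \<Rightarrow> nat ^ 'd \<Rightarrow> complex" where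
  "coef1 f \<alpha> = f \<alpha> * of_real (sqrt (mfact \<alpha>))"

definition of_coef1 :: "(nat ^ 'd \<Rightarrow> complex) \<Rightarrow> 'd::finite series1" where
  "of_coef1 c \<alpha> = c \<alpha> / of_real (sqrt (mfact \<alpha>))"

definition coef2 :: "'d::finite series2 \<Rightarrow> (nat ^ 'd) \<times> (nat ^ 'd) \<Rightarrow> complex" where
  "coef2 a = (\<lambda>(\<alpha>, \<beta>). a (\<alpha>, \<beta>) * of_real (sqrt (mfact \<alpha>) * sqrt (mfact \<beta>)))"

definition of_coef2 :: "((nat ^ 'd) \<times> (nat ^ 'd) \<Rightarrow> complex) \<Rightarrow> 'd::finite series2" where
  "of_coef2 c = (\<lambda>(\<alpha>, \<beta>). c (\<alpha>, \<beta>) / of_real (sqrt (mfact \<alpha>) * sqrt (mfact \<beta>)))"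

definition C_hat :: "ennreal \<Rightarrow> rflat \<Rightarrow> 'd::finite series2 set" where
  "C_hat p s = {a. coef2 a \<in> ell_C p s}"

definition C0_hat :: "ennreal \<Rightarrow> rflat \<Rightarrow> 'd::finite series2 set" where
  "C0_hat p s = {a. coef2 a \<in> ell_C0 p s}"

definition C_hat_star :: "ennreal \<Rightarrow> rflat \<Rightarrow> 'd::finite series2 set" where
  "C_hat_star p s = {a. coef2 a \<in> ell_C_star p s}"

definition C0_hat_star :: "ennreal \<Rightarrow> rflat \<Rightarrow> 'd::finite series2 set" where
  "C0_hat_star p s = {a. coef2 a \<in> ell_C0_star p s}"


section \<open>Wick and anti-Wick operators\<close>

text \<open>The space \<open>A\<^sub>0(\<complex>\<^sup>d)\<close> of polynomials is the type of finitely supported monomial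
  coefficients, so that an operator has exactly \<open>A\<^sub>0\<close> as its domain.\<close>

type_synonym 'd polys = "(nat ^ 'd) \<Rightarrow>\<^sub>0 complex"
type_synonym 'd operators = "'d polys \<Rightarrow> 'd series1"

definition kernel :: "'d::finite series2 \<Rightarrow> 'd series2" where
  "kernel a = cauchy (series_exp pairing) a"

definition Op_wick :: "'d::finite series2 \<Rightarrow> 'd operators" where
  "Op_wick a F = of_coef1 (\<lambda>\<alpha>. \<Sum>\<beta>\<in>Poly_Mapping.keys F.
     coef2 (kernel a) (\<alpha>, \<beta>) * coef1 (Poly_Mapping.lookup F) \<beta>)"

definition T1_star :: "'d::finite series2 \<Rightarrow> 'd series2" where
  "T1_star a = of_coef2 (\<lambda>(\<alpha>, \<beta>). \<Sum>\<^sub>\<infinity>\<gamma>.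
     of_real (sqrt (mbinom (\<alpha> + \<gamma>) \<gamma> * mbinom (\<beta> + \<gamma>) \<gamma>)) * coef2 a (\<alpha> + \<gamma>, \<beta> + \<gamma>))"

definition Op_antiwick :: "'d::finite series2 \<Rightarrow> 'd operators" where
  "Op_antiwick a = Op_wick (T1_star a)"


section \<open>Linear bijections between complex linear spaces\<close>

definition scale_series :: "complex \<Rightarrow> ('i \<Rightarrow> complex) \<Rightarrow> 'i \<Rightarrow> complex" where
  "scale_series k f = (\<lambda>i. k * f i)"

definition scale_op :: "complex \<Rightarrow> ('f \<Rightarrow> 'i \<Rightarrow> complex) \<Rightarrow> 'f \<Rightarrow> 'i \<Rightarrow> complex" where
  "scale_op k T = (\<lambda>F. scale_series k (T F))"

definition linear_bijection ::
  "(complex \<Rightarrow> 'a \<Rightarrow> 'a) \<Rightarrow> (complex \<Rightarrow> 'b \<Rightarrow> 'b) \<Rightarrow>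
   'a::ab_group_add set \<Rightarrow> 'b::ab_group_add set \<Rightarrow> ('a \<Rightarrow> 'b) \<Rightarrow> bool" where
  "linear_bijection sa sb V W T \<longleftrightarrow>
     module.subspace sa V \<and> module.subspace sb W \<and>
     (\<forall>x\<in>V. \<forall>y\<in>V. T (x + y) = T x + T y) \<and>
     (\<forall>k. \<forall>x\<in>V. T (sa k x) = sb k (T x)) \<and>
     bij_betw T V W"

end

theory Submission
  imports Defs
begin

text \<open>On the Taylor derivatives at 0, that is, on the coefficients \<open>c(a; \<alpha>, \<beta>)\<close> times
  \<open>sqrt (\<alpha>! \<beta>!)\<close>, the map \<open>T1_star\<close> is \<open>exp D\<close>, where \<open>D\<close> sums the shifts \<open>(\<alpha>, \<beta>) \<mapsto> (\<alpha> + e\<^sub>j, \<beta> + e\<^sub>j)\<close>; its inverse is \<open>exp (- D)\<close>, and composing the two is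
  legitimate as soon as the series of \<open>exp (2 D)\<close> converges absolutely. The weights are sub- and
  supermultiplicative up to a rescaling of the parameter, and passing from one parameter to another
  gains any geometric factor, so both exponentials are defined on each of the spaces and preserve it.
  Finally, Wick quantisation is injective, since the power series \<open>exp (z, w)\<close> has constant term 1.\<close>

section \<open>The exponential of the shift\<close>

text \<open>Along the diagonal shift the coefficients are controlled by \<open>\<theta> r1 (\<beta>
  + \<gamma>) / \<theta> r2 (\<alpha> + \<gamma>)\<close>, and the two ranges of s come from which
  parameter is free. In \<open>ell_C0\<close> it is r2: it can be taken large, and every geometric
  loss is paid by raising a parameter, which is possible for all s \<le> 1/2. In
  \<open>ell_C\<close> it is r1: it has to be taken small, and the losses are paid by lowering a
  parameter; for the weight exp (r |\<alpha>|), that is at s = 1/2, this fails, hence the strict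
  inequality. The same geometric gain makes the limit spaces independent of p, so that the estimates
  can be done in the sup norm. At s = 0 the weights are infinite outside a ball, and supports
  replace estimates. The starred spaces follow by exchanging \<alpha> and \<beta>, under which D is
  symmetric.\<close>

lemma mlen_add: "mlen (\<alpha> + \<beta>) = mlen \<alpha> + mlen \<beta>"
  by (simp add: mlen_def sum.distrib)

lemma mlen_zero: "mlen 0 = 0"
  by (simp add: mlen_def)

lemma mlen_eq_0_iff: "mlen \<alpha> = 0 \<longleftrightarrow> \<alpha> = 0"
  by (simp add: mlen_def vec_eq_iff)

lemma mfact_pos: "0 < mfact \<alpha>"
  by (simp add: mfact_def prod_pos)

lemma mfact_nonzero [simp]: "mfact \<alpha> \<noteq> 0"
  using mfact_pos[of \<alpha>] by simp

lemma mbinom_nonneg: "0 \<le> mbinom \<alpha> \<beta>"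
  by (simp add: mbinom_def prod_nonneg)

lemma mfact_add: "mfact (\<alpha> + \<gamma>) = mbinom (\<alpha> + \<gamma>) \<gamma> * mfact \<alpha> * mfact \<gamma>"
  unfolding mfact_def mbinom_def prod.distrib[symmetric]
  by (intro prod.cong refl) (simp add: binomial_fact)

lemma mbinom_add: "mbinom (\<alpha> + \<gamma>) \<gamma> = mfact (\<alpha> + \<gamma>) / (mfact \<alpha> * mfact \<gamma>)"
  using mfact_pos[of \<alpha>] mfact_pos[of \<gamma>] by (simp add: mfact_add field_simps)

lemma mbinom_add_le: "mbinom (\<alpha> + \<gamma>) \<gamma> \<le> 2 ^ (mlen \<alpha> + mlen \<gamma>)"
proof -
  have "mbinom (\<alpha> + \<gamma>) \<gamma> \<le> (\<Prod>j\<in>UNIV. 2 ^ ((\<alpha> + \<gamma>) $ j))"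
    unfolding mbinom_def
  proof (intro prod_mono conjI)
    fix j
    have "real (((\<alpha> + \<gamma>) $ j) choose (\<gamma> $ j)) \<le> real (2 ^ ((\<alpha> + \<gamma>) $ j))"
      using binomial_le_pow2 of_nat_le_iff by blast
    then show "real (((\<alpha> + \<gamma>) $ j) choose (\<gamma> $ j)) \<le> 2 ^ ((\<alpha> + \<gamma>) $ j)" by simp
  qed simp
  also have "\<dots> = 2 ^ mlen (\<alpha> + \<gamma>)"
    by (simp add: mlen_def power_sum)
  finally show ?thesis by (simp add: mlen_add)
qed

lemma mbinom_0: "mbinom \<alpha> 0 = 1"
  by (simp add: mbinom_def)

section \<open>Boxes of multi-indices, the binomial theorem and geometric series\<close>

abbreviation mbox :: "nat ^ 'd \<Rightarrow> (nat ^ 'd) set" where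
  "mbox \<kappa> \<equiv> {\<gamma>. \<forall>j. \<gamma> $ j \<le> \<kappa> $ j}"

lemma mbox_eq_image: "mbox (\<kappa> :: nat ^ 'd::finite) = vec_lambda ` (PiE UNIV (\<lambda>j. {..\<kappa> $ j}))"
proof (intro equalityI subsetI)
  fix \<gamma> :: "nat ^ 'd" assume "\<gamma> \<in> mbox \<kappa>"
  then have "($) \<gamma> \<in> PiE UNIV (\<lambda>j. {..\<kappa> $ j})" by (auto simp: PiE_def)
  then have "vec_lambda (($) \<gamma>) \<in> vec_lambda ` (PiE UNIV (\<lambda>j. {..\<kappa> $ j}))" by (rule imageI)
  then show "\<gamma> \<in> vec_lambda ` (PiE UNIV (\<lambda>j. {..\<kappa> $ j}))" by simp
qed (auto simp: PiE_def)

lemma finite_mbox: "finite (mbox (\<kappa> :: nat ^ 'd::finite))"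
  unfolding mbox_eq_image by (intro finite_imageI finite_PiE) auto

text \<open>A box is a product of initial segments, so distributivity reduces sums over it to one
  variable; the binomial theorem and the geometric series below both rest on this.\<close>

lemma sum_mbox_prod:
  fixes f :: "'d::finite \<Rightarrow> nat \<Rightarrow> 'a::comm_semiring_1"
  shows "(\<Sum>\<gamma>\<in>mbox \<kappa>. \<Prod>j\<in>UNIV. f j (\<gamma> $ j)) = (\<Prod>j\<in>UNIV. \<Sum>k\<le>\<kappa> $ j. f j k)"
proof -
  have "inj_on vec_lambda (PiE UNIV (\<lambda>j. {..\<kappa> $ j}))"
    by (metis (mono_tags, lifting) inj_onI vec_lambda_inverse UNIV_I)
  then have "(\<Sum>\<gamma>\<in>mbox \<kappa>. \<Prod>j\<in>UNIV. f j (\<gamma> $ j))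
      = (\<Sum>g\<in>PiE UNIV (\<lambda>j. {..\<kappa> $ j}). \<Prod>j\<in>UNIV. f j (g j))"
    unfolding mbox_eq_image by (simp add: sum.reindex)
  also have "\<dots> = (\<Prod>j\<in>UNIV. \<Sum>k\<le>\<kappa> $ j. f j k)"
    by (rule prod_sum_PiE[symmetric]) auto
  finally show ?thesis .
qed

text \<open>Needed for complex x and y, to sum the composed series, and for the reals x = y = 1, to
  sum the norms.\<close>

lemma multi_binomial:
  fixes x y :: "'a::{comm_ring_1, real_algebra_1}"
  shows "(\<Sum>\<gamma>\<in>mbox \<kappa>. of_real (mbinom \<kappa> \<gamma>) * x ^ mlen \<gamma> * y ^ mlen (\<kappa> - \<gamma>)) = (x + y) ^ mlen \<kappa>"
proof -
  have "of_real (mbinom \<kappa> \<gamma>) * x ^ mlen \<gamma> * y ^ mlen (\<kappa> - \<gamma>)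
    = (\<Prod>j\<in>UNIV. of_nat (\<kappa> $ j choose \<gamma> $ j) * x ^ (\<gamma> $ j) * y ^ (\<kappa> $ j - \<gamma> $ j))" for \<gamma>
    by (simp add: mbinom_def mlen_def power_sum prod.distrib)
  then have "(\<Sum>\<gamma>\<in>mbox \<kappa>. of_real (mbinom \<kappa> \<gamma>) * x ^ mlen \<gamma> * y ^ mlen (\<kappa> - \<gamma>))
    = (\<Prod>j\<in>UNIV. \<Sum>k\<le>\<kappa> $ j. of_nat (\<kappa> $ j choose k) * x ^ k * y ^ (\<kappa> $ j - k))"
    by (simp add: sum_mbox_prod[of "\<lambda>j k. of_nat (\<kappa> $ j choose k) * x ^ k * y ^ (\<kappa> $ j - k)"])
  also have "\<dots> = (\<Prod>j\<in>UNIV. (x + y) ^ (\<kappa> $ j))"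
    by (simp add: binomial_ring)
  finally show ?thesis by (simp add: mlen_def power_sum)
qed

lemma nth_le_mlen: "\<gamma> $ j \<le> mlen \<gamma>"
  unfolding mlen_def by (rule member_le_sum) auto

lemma finite_mlen_le: "finite {\<gamma> :: nat ^ 'd::finite. mlen \<gamma> \<le> N}"
  by (rule finite_subset[OF _ finite_mbox[of "\<chi> j. N"]]) (auto intro: order_trans[OF nth_le_mlen])

lemma summable_on_power_mlen:
  fixes x :: real
  assumes "0 \<le> x" "x < 1"
  shows "(\<lambda>\<gamma> :: nat ^ 'd::finite. x ^ mlen \<gamma>) summable_on UNIV"
proof (rule nonneg_bdd_above_summable_on)
  show "bdd_above (sum (\<lambda>\<gamma> :: nat ^ 'd. x ^ mlen \<gamma>) ` {F. F \<subseteq> UNIV \<and> finite F})"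
  proof (rule bdd_aboveI2)
    fix F :: "(nat ^ 'd) set" assume "F \<in> {F. F \<subseteq> UNIV \<and> finite F}"
    then have fin: "finite F" by simp
    \<comment> \<open>A cube containing F; its side is the largest length occurring in F, with 0
      inserted to cover the empty set.\<close>
    define \<kappa> :: "nat ^ 'd" where "\<kappa> = (\<chi> j. Max (insert 0 (mlen ` F)))"
    have sub: "F \<subseteq> mbox \<kappa>"
      using fin by (auto simp: \<kappa>_def intro!: order_trans[OF nth_le_mlen] Max_ge)
    have "(\<Sum>\<gamma>\<in>F. x ^ mlen \<gamma>) \<le> (\<Sum>\<gamma>\<in>mbox \<kappa>. x ^ mlen \<gamma>)"
      by (rule sum_mono2) (use assms sub finite_mbox in auto)
    also have "\<dots> = (\<Prod>j\<in>UNIV. \<Sum>k\<le>\<kappa> $ j. x ^ k)"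
      by (simp add: mlen_def power_sum sum_mbox_prod[of "\<lambda>_ k. x ^ k"])
    also have "\<dots> \<le> (\<Prod>j\<in>(UNIV :: 'd set). 1 / (1 - x))"
    proof (intro prod_mono conjI sum_nonneg)
      fix j :: 'd
      have "(\<Sum>k\<le>\<kappa> $ j. x ^ k) \<le> suminf (\<lambda>k. x ^ k)"
        by (rule sum_le_suminf) (use assms in \<open>auto intro: summable_geometric\<close>)
      then show "(\<Sum>k\<le>\<kappa> $ j. x ^ k) \<le> 1 / (1 - x)"
        using assms by (simp add: suminf_geometric)
    qed (use assms in auto)
    finally show "(\<Sum>\<gamma>\<in>F. x ^ mlen \<gamma>) \<le> (\<Prod>j\<in>(UNIV :: 'd set). 1 / (1 - x))" .
  qed
qed (use assms in auto)

text \<open>Equal to \<open>sqrt ((\<alpha> + \<gamma>)! (\<beta> + \<gamma>)! / (\<alpha>!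
  \<beta>!)) / \<gamma>!\<close>: the square root converts from Taylor derivatives to coefficients
  with respect to \<open>e\<^sub>\<alpha>\<close>, and \<gamma>! is the denominator of the
  exponential series.\<close>

definition shift_weight :: "nat ^ 'd \<Rightarrow> nat ^ 'd \<Rightarrow> nat ^ 'd \<Rightarrow> real" where
  "shift_weight \<alpha> \<beta> \<gamma> = sqrt (mbinom (\<alpha> + \<gamma>) \<gamma> * mbinom (\<beta> + \<gamma>) \<gamma>)"

text \<open>On formal power series this is \<open>exp (t \<Sum>\<^sub>j \<partial>\<^sub>z\<^sub>j \<partial>\<^sub>w\<^sub>j)\<close>, a one-parameter group in \<open>t\<close>.\<close>

definition shift_exp ::
    "complex \<Rightarrow> ((nat ^ 'd) \<times> (nat ^ 'd) \<Rightarrow> complex) \<Rightarrow> (nat ^ 'd) \<times> (nat ^ 'd) \<Rightarrow> complex" where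
  "shift_exp t c = (\<lambda>(\<alpha>, \<beta>).
     \<Sum>\<^sub>\<infinity>\<gamma>. t ^ mlen \<gamma> * of_real (shift_weight \<alpha> \<beta> \<gamma>) * c (\<alpha> + \<gamma>, \<beta> + \<gamma>))"

definition shift_summable :: "((nat ^ 'd) \<times> (nat ^ 'd) \<Rightarrow> complex) \<Rightarrow> bool" where
  "shift_summable c \<longleftrightarrow>
     (\<forall>\<alpha> \<beta>. (\<lambda>\<gamma>. 2 ^ mlen \<gamma> * shift_weight \<alpha> \<beta> \<gamma> * cmod (c (\<alpha> + \<gamma>, \<beta> + \<gamma>))) summable_on UNIV)"

lemma shift_weight_nonneg: "0 \<le> shift_weight \<alpha> \<beta> \<gamma>"
  by (simp add: shift_weight_def mbinom_nonneg)

lemma shift_weight_0: "shift_weight \<alpha> \<beta> 0 = 1"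
  by (simp add: shift_weight_def mbinom_0)

lemma shift_weight_commute: "shift_weight \<alpha> \<beta> \<gamma> = shift_weight \<beta> \<alpha> \<gamma>"
  by (simp add: shift_weight_def mult.commute)

lemma shift_weight_le: "shift_weight \<alpha> \<beta> \<gamma> \<le> 2 ^ (mlen \<alpha> + mlen \<beta> + mlen \<gamma>)"
proof -
  have "mbinom (\<alpha> + \<gamma>) \<gamma> * mbinom (\<beta> + \<gamma>) \<gamma>
      \<le> 2 ^ (mlen \<alpha> + mlen \<gamma>) * 2 ^ (mlen \<beta> + mlen \<gamma>)"
    by (intro mult_mono mbinom_add_le mbinom_nonneg) auto
  \<comment> \<open>Doubling the share of \<alpha> and \<beta> makes the bound a perfect square, so
    no half powers of 2 arise.\<close>
  also have "\<dots> \<le> 2 ^ (2 * (mlen \<alpha> + mlen \<beta> + mlen \<gamma>))"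
    unfolding power_add[symmetric] by (rule power_increasing) auto
  also have "\<dots> = (2 ^ (mlen \<alpha> + mlen \<beta> + mlen \<gamma>))\<^sup>2"
    by (simp add: power_mult[symmetric] mult.commute)
  finally show ?thesis
    unfolding shift_weight_def by (rule real_le_lsqrt[rotated 1]) simp
qed

text \<open>The rule for products of divided powers, x^\<gamma>/\<gamma>! times
  x^\<delta>/\<delta>!. Each of the two variables contributes one factor
  \<open>mbinom (\<gamma> + \<delta>) \<gamma>\<close> under the root, so the root
  disappears.\<close>

lemma shift_weight_mult:
  "shift_weight \<alpha> \<beta> \<gamma> * shift_weight (\<alpha> + \<gamma>) (\<beta> + \<gamma>) \<delta>
     = shift_weight \<alpha> \<beta> (\<gamma> + \<delta>) * mbinom (\<gamma> + \<delta>) \<gamma>"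
proof -
  have b: "mbinom (\<gamma> + \<delta>) \<gamma> = mfact (\<gamma> + \<delta>) / (mfact \<delta> * mfact \<gamma>)"
    using mbinom_add[of \<delta> \<gamma>] by (simp add: add.commute)
  have e: "mbinom (x + \<gamma>) \<gamma> * mbinom (x + \<gamma> + \<delta>) \<delta>
     = mbinom (x + (\<gamma> + \<delta>)) (\<gamma> + \<delta>) * mbinom (\<gamma> + \<delta>) \<gamma>" for x
    unfolding mbinom_add b by (simp add: field_simps add.assoc)
  have "shift_weight \<alpha> \<beta> \<gamma> * shift_weight (\<alpha> + \<gamma>) (\<beta> + \<gamma>) \<delta>
    = sqrt ((mbinom (\<alpha> + \<gamma>) \<gamma> * mbinom (\<alpha> + \<gamma> + \<delta>) \<delta>) * (mbinom (\<beta> + \<gamma>) \<gamma> * mbinom (\<beta> + \<gamma> + \<delta>) \<delta>))"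
    by (simp add: shift_weight_def real_sqrt_mult)
  also have "\<dots> = shift_weight \<alpha> \<beta> (\<gamma> + \<delta>) * sqrt ((mbinom (\<gamma> + \<delta>) \<gamma>)\<^sup>2)"
    unfolding e shift_weight_def by (simp add: real_sqrt_mult power2_eq_square)
  finally show ?thesis by (simp add: mbinom_nonneg)
qed

lemma shift_exp_summable:
  assumes "shift_summable c" "cmod t \<le> 2"
  shows "(\<lambda>\<gamma>. t ^ mlen \<gamma> * of_real (shift_weight \<alpha> \<beta> \<gamma>) * c (\<alpha> + \<gamma>, \<beta> + \<gamma>)) summable_on UNIV"
proof (rule abs_summable_summable, rule summable_on_comparison_test)
  show "(\<lambda>\<gamma>. 2 ^ mlen \<gamma> * shift_weight \<alpha> \<beta> \<gamma> * cmod (c (\<alpha> + \<gamma>, \<beta> + \<gamma>))) summable_on UNIV"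
    using assms(1) by (simp add: shift_summable_def)
qed (use assms(2) in \<open>auto simp: norm_mult norm_power shift_weight_nonneg
       intro!: mult_right_mono power_mono\<close>)

text \<open>The regrouping of pairs by their sum \<kappa>. The subtraction of naturals is a true
  inverse, because \<gamma> stays inside the box.\<close>

lemma bij_betw_mbox:
  "bij_betw (\<lambda>(\<kappa>, \<gamma>). (\<gamma>, \<kappa> - \<gamma>)) (SIGMA \<kappa>:UNIV. mbox \<kappa>) (UNIV :: ((nat ^ 'd::finite) \<times> (nat ^ 'd)) set)"
  by (rule bij_betwI[where g = "\<lambda>(\<gamma>, \<delta>). (\<gamma> + \<delta>, \<gamma>)"]) (auto simp: vec_eq_iff)

lemma mbox_add_diff: "\<gamma> \<in> mbox \<kappa> \<Longrightarrow> \<gamma> + (\<kappa> - \<gamma>) = \<kappa>"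
  by (auto simp: vec_eq_iff)

text \<open>Grouping the double series by \<open>\<kappa> = \<gamma> + \<delta>\<close>, the binomial theorem produces \<open>(s + t)\<^bsup>|\<kappa>|\<^esup>\<close>;
  for the absolute values it produces \<open>2\<^bsup>|\<kappa>|\<^esup>\<close>, whence the factor in \<open>shift_summable\<close>.\<close>

lemma shift_exp_comp:
  fixes c :: "(nat ^ 'd::finite) \<times> (nat ^ 'd) \<Rightarrow> complex"
  assumes c: "shift_summable c" and st: "cmod s \<le> 1" "cmod t \<le> 1"
  shows "shift_exp s (shift_exp t c) = shift_exp (s + t) c"
proof (rule ext, clarify)
  fix \<alpha> \<beta> :: "nat ^ 'd"
  define Q where "Q \<kappa> = of_real (shift_weight \<alpha> \<beta> \<kappa>) * c (\<alpha> + \<kappa>, \<beta> + \<kappa>)" for \<kappa>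
  define g where "g = (\<lambda>(\<gamma>, \<delta>). s ^ mlen \<gamma> * t ^ mlen \<delta> * of_real (mbinom (\<gamma> + \<delta>) \<gamma>) * Q (\<gamma> + \<delta>))"
  let ?S = "SIGMA \<kappa>:UNIV. mbox \<kappa>"
  let ?h = "\<lambda>(\<kappa>, \<gamma>). (\<gamma>, \<kappa> - \<gamma>)"
  have gh: "g (?h (\<kappa>, \<gamma>)) = of_real (mbinom \<kappa> \<gamma>) * s ^ mlen \<gamma> * t ^ mlen (\<kappa> - \<gamma>) * Q \<kappa>"
    if "\<gamma> \<in> mbox \<kappa>" for \<kappa> \<gamma>
    using mbox_add_diff[OF that] by (simp add: g_def)
  have normgh: "(\<Sum>\<gamma>\<in>mbox \<kappa>. norm (g (?h (\<kappa>, \<gamma>)))) \<le> 2 ^ mlen \<kappa> * norm (Q \<kappa>)" for \<kappa>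
  proof -
    have "(\<Sum>\<gamma>\<in>mbox \<kappa>. norm (g (?h (\<kappa>, \<gamma>))))
        \<le> (\<Sum>\<gamma>\<in>mbox \<kappa>. mbinom \<kappa> \<gamma> * 1 ^ mlen \<gamma> * 1 ^ mlen (\<kappa> - \<gamma>) * norm (Q \<kappa>))"
    proof (rule sum_mono)
      fix \<gamma> assume "\<gamma> \<in> mbox \<kappa>"
      then show "norm (g (?h (\<kappa>, \<gamma>))) \<le> mbinom \<kappa> \<gamma> * 1 ^ mlen \<gamma> * 1 ^ mlen (\<kappa> - \<gamma>) * norm (Q \<kappa>)"
        unfolding gh[OF \<open>\<gamma> \<in> mbox \<kappa>\<close>] norm_mult norm_power norm_of_real using st mbinom_nonneg[of \<kappa> \<gamma>]
        by (intro mult_mono power_mono) (auto simp: mbinom_nonneg intro!: mult_nonneg_nonneg)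
    qed
    also have "\<dots> = 2 ^ mlen \<kappa> * norm (Q \<kappa>)"
      using multi_binomial[of \<kappa> "1::real" 1] by (simp add: sum_distrib_right[symmetric])
    finally show ?thesis .
  qed
  have Qsum: "(\<lambda>\<kappa>. 2 ^ mlen \<kappa> * norm (Q \<kappa>)) summable_on UNIV"
    using c by (simp add: shift_summable_def Q_def norm_mult shift_weight_nonneg mult.assoc)
  \<comment> \<open>The fibres are finite, so absolute convergence reduces to the single sum
    \<open>Qsum\<close>; it justifies both interchanges below, over the pairs and over the
    fibres.\<close>
  have "(\<lambda>x. norm (g (?h x))) summable_on ?S"
  proof (rule iffD2[OF Infinite_Sum.abs_summable_on_Sigma_iff], intro conjI ballI)
    show "(\<lambda>\<kappa>. norm (\<Sum>\<^sub>\<infinity>\<gamma>\<in>mbox \<kappa>. norm (g (?h (\<kappa>, \<gamma>))))) summable_on UNIV"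
      by (rule summable_on_comparison_test[OF Qsum])
         (use normgh in \<open>auto simp: finite_mbox sum_nonneg\<close>)
  qed (simp_all add: finite_mbox)
  then have gsum_h: "(\<lambda>x. g (?h x)) summable_on ?S"
    by (rule abs_summable_summable)
  then have gsum: "g summable_on UNIV \<times> UNIV"
    using summable_on_reindex_bij_betw[OF bij_betw_mbox, of g] by simp
  have "shift_exp s (shift_exp t c) (\<alpha>, \<beta>) = (\<Sum>\<^sub>\<infinity>\<gamma>. \<Sum>\<^sub>\<infinity>\<delta>. g (\<gamma>, \<delta>))"
    unfolding shift_exp_def prod.case
  proof (intro infsum_cong)
    fix \<gamma>
    have "s ^ mlen \<gamma> * of_real (shift_weight \<alpha> \<beta> \<gamma>) *
        (t ^ mlen \<delta> * of_real (shift_weight (\<alpha> + \<gamma>) (\<beta> + \<gamma>) \<delta>) * c (\<alpha> + \<gamma> + \<delta>, \<beta> + \<gamma> + \<delta>)) = g (\<gamma>, \<delta>)" for \<delta>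
      using arg_cong[OF shift_weight_mult[of \<alpha> \<beta> \<gamma> \<delta>], of complex_of_real]
      by (simp add: g_def Q_def add.assoc algebra_simps)
    then show "s ^ mlen \<gamma> * of_real (shift_weight \<alpha> \<beta> \<gamma>) *
        (\<Sum>\<^sub>\<infinity>\<delta>. t ^ mlen \<delta> * of_real (shift_weight (\<alpha> + \<gamma>) (\<beta> + \<gamma>) \<delta>) * c (\<alpha> + \<gamma> + \<delta>, \<beta> + \<gamma> + \<delta>))
        = (\<Sum>\<^sub>\<infinity>\<delta>. g (\<gamma>, \<delta>))"
      by (simp add: infsum_cmult_right'[symmetric])
  qed
  also have "\<dots> = infsum g (UNIV \<times> UNIV)"
    using infsum_Sigma'_banach[of "\<lambda>x y. g (x, y)" UNIV "\<lambda>_. UNIV"] gsum by simp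
  also have "\<dots> = (\<Sum>\<^sub>\<infinity>x\<in>?S. g (?h x))"
    using infsum_reindex_bij_betw[OF bij_betw_mbox, of g] by simp
  also have "\<dots> = (\<Sum>\<^sub>\<infinity>\<kappa>. \<Sum>\<^sub>\<infinity>\<gamma>\<in>mbox \<kappa>. g (?h (\<kappa>, \<gamma>)))"
    by (rule infsum_Sigma_banach[symmetric]) (use gsum_h in auto)
  also have "\<dots> = (\<Sum>\<^sub>\<infinity>\<kappa>. (s + t) ^ mlen \<kappa> * Q \<kappa>)"
  proof (rule infsum_cong)
    fix \<kappa> :: "nat ^ 'd"
    have "(\<Sum>\<^sub>\<infinity>\<gamma>\<in>mbox \<kappa>. g (?h (\<kappa>, \<gamma>)))
        = (\<Sum>\<gamma>\<in>mbox \<kappa>. of_real (mbinom \<kappa> \<gamma>) * s ^ mlen \<gamma> * t ^ mlen (\<kappa> - \<gamma>) * Q \<kappa>)"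
      using gh by (simp add: finite_mbox)
    also have "\<dots> = (s + t) ^ mlen \<kappa> * Q \<kappa>"
      by (simp add: sum_distrib_right[symmetric] multi_binomial)
    finally show "(\<Sum>\<^sub>\<infinity>\<gamma>\<in>mbox \<kappa>. g (?h (\<kappa>, \<gamma>))) = (s + t) ^ mlen \<kappa> * Q \<kappa>" .
  qed
  finally show "shift_exp s (shift_exp t c) (\<alpha>, \<beta>) = shift_exp (s + t) c (\<alpha>, \<beta>)"
    by (simp add: shift_exp_def Q_def mult.assoc)
qed

text \<open>The term \<gamma> = 0 survives by \<open>0 ^ 0 = 1\<close>, and all others carry a
  positive power of 0.\<close>

lemma shift_exp_0: "shift_exp 0 c = c"
proof (rule ext, clarify)
  fix \<alpha> \<beta> :: "nat ^ 'a"
  have "shift_exp 0 c (\<alpha>, \<beta>)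
      = (\<Sum>\<^sub>\<infinity>\<gamma>\<in>{0}. 0 ^ mlen \<gamma> * of_real (shift_weight \<alpha> \<beta> \<gamma>) * c (\<alpha> + \<gamma>, \<beta> + \<gamma>))"
    unfolding shift_exp_def prod.case
    by (rule infsum_cong_neutral) (auto simp: mlen_eq_0_iff)
  then show "shift_exp 0 c (\<alpha>, \<beta>) = c (\<alpha>, \<beta>)"
    by (simp add: shift_weight_0 mlen_zero)
qed

section \<open>Anti-Wick operators from a stable coefficient space\<close>

lemma module_scale_series: "module (scale_series :: complex \<Rightarrow> ('i \<Rightarrow> complex) \<Rightarrow> _)"
  by unfold_locales (auto simp: scale_series_def fun_eq_iff algebra_simps)

lemma module_scale_op: "module (scale_op :: complex \<Rightarrow> ('f \<Rightarrow> 'i \<Rightarrow> complex) \<Rightarrow> _)"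
  by unfold_locales (auto simp: scale_op_def scale_series_def fun_eq_iff algebra_simps)

lemma coef2_add: "coef2 (a + b) = coef2 a + coef2 b"
  by (auto simp: coef2_def fun_eq_iff algebra_simps)

lemma coef2_scale: "coef2 (scale_series k a) = scale_series k (coef2 a)"
  by (auto simp: coef2_def scale_series_def fun_eq_iff)

lemma of_coef2_add: "of_coef2 (a + b) = of_coef2 a + of_coef2 b"
  by (auto simp: of_coef2_def fun_eq_iff add_divide_distrib)

lemma of_coef2_scale: "of_coef2 (scale_series k a) = scale_series k (of_coef2 a)"
  by (auto simp: of_coef2_def scale_series_def fun_eq_iff)

lemma coef2_of_coef2 [simp]: "coef2 (of_coef2 c) = c"
  by (auto simp: coef2_def of_coef2_def fun_eq_iff)

lemma of_coef2_coef2 [simp]: "of_coef2 (coef2 a) = a"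
  by (auto simp: coef2_def of_coef2_def fun_eq_iff)

lemma coef2_zero: "coef2 (\<lambda>_. 0) = (\<lambda>_. 0)"
  by (auto simp: coef2_def fun_eq_iff)

lemma T1_star_eq: "T1_star a = of_coef2 (shift_exp 1 (coef2 a))"
  by (simp add: T1_star_def shift_exp_def shift_weight_def)

text \<open>Summability is assumed because a divergent \<open>infsum\<close> has the default value
  0, which would break additivity.\<close>

lemma shift_exp_add:
  assumes "shift_summable c" "shift_summable c'" "cmod t \<le> 2"
  shows "shift_exp t (c + c') = shift_exp t c + shift_exp t c'"
  using infsum_add[OF shift_exp_summable[OF assms(1,3)] shift_exp_summable[OF assms(2,3)]]
  by (auto simp: shift_exp_def fun_eq_iff distrib_left)

lemma shift_exp_scale: "shift_exp t (scale_series k c) = scale_series k (shift_exp t c)"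
  by (auto simp: shift_exp_def scale_series_def fun_eq_iff mult.left_commute[of _ k]
      infsum_cmult_right' intro!: ext)

lemma cauchy_add: "cauchy f (a + b) = cauchy f a + cauchy f b"
  by (auto simp: cauchy_def fun_eq_iff distrib_left sum.distrib case_prod_unfold)

lemma cauchy_scale: "cauchy f (scale_series k a) = scale_series k (cauchy f a)"
  by (auto simp: cauchy_def scale_series_def fun_eq_iff sum_distrib_left case_prod_unfold
      mult.left_commute)

lemma Op_wick_add: "Op_wick (a + b) = Op_wick a + Op_wick b"
  by (auto simp: Op_wick_def kernel_def cauchy_add coef2_add of_coef1_def fun_eq_iff
      distrib_right sum.distrib add_divide_distrib)

lemma Op_wick_scale: "Op_wick (scale_series k a) = scale_op k (Op_wick a)"
proof -
  have "coef2 (kernel (scale_series k a)) (\<alpha>, \<beta>) = k * coef2 (kernel a) (\<alpha>, \<beta>)" for \<alpha> \<beta>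
    unfolding kernel_def cauchy_scale coef2_scale by (simp add: scale_series_def)
  then show ?thesis
    by (auto simp: Op_wick_def of_coef1_def fun_eq_iff scale_op_def scale_series_def
        sum_distrib_left mult.assoc)
qed

section \<open>Injectivity of Wick quantisation\<close>

lemma finite_antidiagonal:
  fixes \<kappa> :: "(nat ^ 'd::finite) \<times> (nat ^ 'd)"
  shows "finite {(\<mu>, \<nu>). \<mu> + \<nu> = \<kappa>}"
proof (rule finite_subset)
  show "{(\<mu>, \<nu>). \<mu> + \<nu> = \<kappa>}
    \<subseteq> (mbox (fst \<kappa>) \<times> mbox (snd \<kappa>)) \<times> (mbox (fst \<kappa>) \<times> mbox (snd \<kappa>))"
    by auto
qed (simp add: finite_mbox)

text \<open>Induction on the total degree: in the coefficient of the product at \<kappa>, the value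
  at \<kappa> occurs only with the factor \<open>f 0\<close>, and all other terms involve values of
  smaller degree.\<close>

lemma cauchy_inj:
  fixes f :: "'d::finite series2"
  assumes f0: "f 0 \<noteq> 0" and eq: "cauchy f a = cauchy f b"
  shows "a = b"
proof -
  have "\<forall>\<kappa>. mlen (fst \<kappa>) + mlen (snd \<kappa>) = n \<longrightarrow> a \<kappa> = b \<kappa>" for n
  proof (induction n rule: less_induct)
    case (less n)
    show ?case
    proof (intro allI impI)
      fix \<kappa> :: "(nat ^ 'd) \<times> (nat ^ 'd)"
      assume n: "mlen (fst \<kappa>) + mlen (snd \<kappa>) = n"
      let ?D = "{(\<mu>, \<nu>). \<mu> + \<nu> = \<kappa>}"
      have rest: "(case p of (\<mu>, \<nu>) \<Rightarrow> f \<mu> * a \<nu>) = (case p of (\<mu>, \<nu>) \<Rightarrow> f \<mu> * b \<nu>)"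
        if "p \<in> ?D - {(0, \<kappa>)}" for p
      proof -
        obtain \<mu> \<nu> where p: "p = (\<mu>, \<nu>)" by (cases p)
        from that have s: "\<mu> + \<nu> = \<kappa>" and "\<mu> \<noteq> 0" by (auto simp: p)
        then have "mlen (fst \<mu>) + mlen (snd \<mu>) \<noteq> 0"
          by (auto simp: mlen_eq_0_iff prod_eq_iff)
        moreover have "mlen (fst \<mu>) + mlen (snd \<mu>) + (mlen (fst \<nu>) + mlen (snd \<nu>)) = n"
          using n by (simp add: s[symmetric] mlen_add)
        ultimately have "mlen (fst \<nu>) + mlen (snd \<nu>) < n" by linarith
        with less.IH have "a \<nu> = b \<nu>" by blast
        then show ?thesis by (simp add: p)
      qed
      have split: "cauchy f c \<kappa> = f 0 * c \<kappa> + (\<Sum>(\<mu>, \<nu>)\<in>?D - {(0, \<kappa>)}. f \<mu> * c \<nu>)" for c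
        unfolding cauchy_def by (subst sum.remove[OF finite_antidiagonal, of "(0, \<kappa>)"]) auto
      have "(\<Sum>(\<mu>, \<nu>)\<in>?D - {(0, \<kappa>)}. f \<mu> * a \<nu>) = (\<Sum>(\<mu>, \<nu>)\<in>?D - {(0, \<kappa>)}. f \<mu> * b \<nu>)"
        by (rule sum.cong[OF refl rest])
      then have "f 0 * a \<kappa> = f 0 * b \<kappa>"
        using split[of a] split[of b] eq by (metis add_right_cancel)
      then show "a \<kappa> = b \<kappa>" using f0 by (metis mult_cancel_left)
    qed
  qed
  then show ?thesis by (auto simp: fun_eq_iff)
qed

text \<open>The pairing has no constant term, so among its powers only the zeroth contributes at
  0.\<close>

lemma series_exp_pairing_0: "series_exp (pairing :: 'd::finite series2) 0 = 1"
proof -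
  have D0: "{(\<mu>, \<nu>). \<mu> + \<nu> = (0 :: (nat ^ 'd) \<times> (nat ^ 'd))} = {(0, 0)}"
    by (auto simp: prod_eq_iff vec_eq_iff)
  have p0: "pairing (0 :: (nat ^ 'd) \<times> (nat ^ 'd)) = 0"
    by (auto simp: pairing_def prod_eq_iff axis_eq_0_iff intro!: sum.neutral)
  have "series_power (pairing :: 'd series2) n 0 = (if n = 0 then 1 else 0)" for n
    by (cases n) (simp_all add: series_power_def series_one_def cauchy_def D0 p0)
  then have "series_exp (pairing :: 'd series2) 0
      = suminf (\<lambda>n. if n = 0 then 1 else (0 :: complex))"
    by (auto simp: series_exp_def intro!: arg_cong[of _ _ suminf])
  also have "\<dots> = (\<Sum>n\<in>{0 :: nat}. if n = 0 then 1 else 0)"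
    by (rule suminf_finite) auto
  finally show ?thesis by simp
qed

lemma Op_wick_inj: "inj Op_wick"
proof (rule injI)
  fix a b :: "'d::finite series2"
  assume eq: "Op_wick a = Op_wick b"
  \<comment> \<open>Monomials read off the kernel column by column; the factor
    \<open>sqrt (mfact \<beta>)\<close> appears because \<open>single \<beta> 1\<close> is that
    multiple of \<open>e\<^sub>\<beta>\<close>.\<close>
  have val: "Op_wick c (Poly_Mapping.single \<beta> 1) \<alpha>
      = coef2 (kernel c) (\<alpha>, \<beta>) * of_real (sqrt (mfact \<beta>)) / of_real (sqrt (mfact \<alpha>))"
    for c :: "'d series2" and \<alpha> \<beta>
    by (simp add: Op_wick_def of_coef1_def coef1_def)
  have "coef2 (kernel a) (\<alpha>, \<beta>) = coef2 (kernel b) (\<alpha>, \<beta>)" for \<alpha> \<beta>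
    using fun_cong[OF fun_cong[OF eq, of "Poly_Mapping.single \<beta> 1"], of \<alpha>] by (simp add: val)
  then have "coef2 (kernel a) = coef2 (kernel b)" by (auto simp: fun_eq_iff)
  then have "kernel a = kernel b" by (metis of_coef2_coef2)
  then show "a = b"
    unfolding kernel_def by (rule cauchy_inj[rotated]) (simp add: series_exp_pairing_0)
qed

text \<open>The interface between algebra and analysis: summability gives additivity and the group
  law, and invariance under the parameter -1 gives surjectivity.\<close>

definition shift_stable :: "((nat ^ 'd) \<times> (nat ^ 'd) \<Rightarrow> complex) set \<Rightarrow> bool" where
  "shift_stable X \<longleftrightarrow> module.subspace scale_series X \<and>
     (\<forall>c\<in>X. shift_summable c \<and> shift_exp 1 c \<in> X \<and> shift_exp (- 1) c \<in> X)"

lemma shift_stable_bij_betw: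
  fixes X :: "((nat ^ 'd::finite) \<times> (nat ^ 'd) \<Rightarrow> complex) set"
  assumes "shift_stable X"
  shows "bij_betw (shift_exp 1) X X"
  by (rule bij_betwI[where g = "shift_exp (- 1)"])
     (use assms in \<open>auto simp: shift_stable_def shift_exp_comp shift_exp_0\<close>)

text \<open>Anti-Wick quantisation factors as \<open>Op_wick\<close>, \<open>of_coef2\<close>,
  \<open>shift_exp 1\<close>, \<open>coef2\<close>. The coefficient maps are mutually inverse, and
  \<open>Op_wick\<close> is injective with its image as target, so everything rests on the
  shift.\<close>

lemma linear_bijection_Op_antiwick:
  fixes X :: "((nat ^ 'd::finite) \<times> (nat ^ 'd) \<Rightarrow> complex) set"
  assumes X: "shift_stable X"
  shows "linear_bijection scale_series scale_op {a. coef2 a \<in> X} (Op_wick ` {a. coef2 a \<in> X}) Op_antiwick"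
proof -
  let ?V = "{a. coef2 a \<in> X}"
  have subX: "module.subspace scale_series X" and sm: "\<And>c. c \<in> X \<Longrightarrow> shift_summable c"
    using X by (auto simp: shift_stable_def)
  have subV: "module.subspace scale_series ?V"
    using subX unfolding module.subspace_def[OF module_scale_series]
    by (simp add: coef2_add coef2_scale coef2_zero zero_fun_def)
  have subW: "module.subspace scale_op (Op_wick ` ?V)"
  proof (subst module.subspace_def[OF module_scale_op], intro conjI ballI allI)
    have "Op_wick 0 = (0 :: 'd operators)"
      using Op_wick_add[of 0 0] by simp
    then show "0 \<in> Op_wick ` ?V"
      using subV unfolding module.subspace_def[OF module_scale_series] by (metis imageI)
  next
    fix x y assume "x \<in> Op_wick ` ?V" "y \<in> Op_wick ` ?V"
    then show "x + y \<in> Op_wick ` ?V"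
      using subV unfolding module.subspace_def[OF module_scale_series]
      by (auto simp: Op_wick_add[symmetric])
  next
    fix k x assume "x \<in> Op_wick ` ?V"
    then show "scale_op k x \<in> Op_wick ` ?V"
      using subV unfolding module.subspace_def[OF module_scale_series]
      by (auto simp: Op_wick_scale[symmetric])
  qed
  have bij_coef: "bij_betw coef2 ?V X" "bij_betw of_coef2 X ?V"
    by (rule bij_betwI[where g = of_coef2]; auto) (rule bij_betwI[where g = coef2]; auto)
  have "bij_betw (of_coef2 \<circ> (shift_exp 1 \<circ> coef2)) ?V ?V"
    by (rule bij_betw_trans[OF bij_betw_trans[OF bij_coef(1) shift_stable_bij_betw[OF X]] bij_coef(2)])
  then have "bij_betw T1_star ?V ?V"
    by (simp add: T1_star_eq[abs_def] o_def)
  then have "bij_betw (Op_wick \<circ> T1_star) ?V (Op_wick ` ?V)"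
    by (rule bij_betw_trans) (simp add: bij_betw_def inj_on_subset[OF Op_wick_inj])
  then have bij: "bij_betw Op_antiwick ?V (Op_wick ` ?V)"
    by (simp add: Op_antiwick_def[abs_def] o_def)
  show ?thesis
    unfolding linear_bijection_def
    using subV subW bij
    by (auto simp: Op_antiwick_def T1_star_eq coef2_add coef2_scale shift_exp_add sm shift_exp_scale
        of_coef2_add of_coef2_scale Op_wick_add Op_wick_scale)
qed

section \<open>Exchange of the two variables\<close>

definition swap_series :: "('i \<times> 'i \<Rightarrow> complex) \<Rightarrow> 'i \<times> 'i \<Rightarrow> complex" where
  "swap_series c = (\<lambda>(\<alpha>, \<beta>). c (\<beta>, \<alpha>))"

text \<open>The shift moves both multi-indices by the same \<gamma> and its weight is symmetric in
  them, so it commutes with the exchange.\<close>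

lemma shift_stable_swap:
  assumes "shift_stable X"
  shows "shift_stable {c. swap_series c \<in> X}"
proof -
  have swap: "swap_series (c + c') = swap_series c + swap_series c'"
    "swap_series (scale_series k c) = scale_series k (swap_series c)"
    "swap_series 0 = 0" for c c' :: "'i \<times> 'i \<Rightarrow> complex" and k
    by (auto simp: swap_series_def scale_series_def fun_eq_iff)
  have "shift_exp t (swap_series c) = swap_series (shift_exp t c)" for t and c :: "(nat ^ 'a) \<times> (nat ^ 'a) \<Rightarrow> complex"
    by (auto simp: shift_exp_def swap_series_def fun_eq_iff shift_weight_commute)
  moreover have "shift_summable (swap_series c) \<longleftrightarrow> shift_summable c" for c :: "(nat ^ 'a) \<times> (nat ^ 'a) \<Rightarrow> complex"
    unfolding shift_summable_def swap_series_def prod.case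
    by (subst shift_weight_commute) blast
  ultimately show ?thesis
    using assms unfolding shift_stable_def module.subspace_def[OF module_scale_series]
    by (auto simp: swap)
qed

section \<open>Families of weights\<close>

text \<open>Membership in the weighted sup-norm space for \<omega> with parameters r2 and r1, with
  the division cleared.\<close>

definition weight_bound ::
    "(real \<Rightarrow> nat ^ 'd \<Rightarrow> real) \<Rightarrow> real \<Rightarrow> real \<Rightarrow> ((nat ^ 'd) \<times> (nat ^ 'd) \<Rightarrow> complex) \<Rightarrow> bool" where
  "weight_bound \<theta> r2 r1 c \<longleftrightarrow> (\<exists>C. \<forall>\<alpha> \<beta>. cmod (c (\<alpha>, \<beta>)) * \<theta> r2 \<alpha> \<le> C * \<theta> r1 \<beta>)"

locale weight_family =
  fixes \<theta> :: "real \<Rightarrow> nat ^ 'd::finite \<Rightarrow> real" and A :: real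
  assumes A_ge_1: "1 \<le> A"
    and pos: "0 < r \<Longrightarrow> 0 < \<theta> r \<alpha>"
    and mono: "0 < r \<Longrightarrow> r \<le> r' \<Longrightarrow> \<theta> r \<alpha> \<le> \<theta> r' \<alpha>"
    and submult: "0 < r \<Longrightarrow> \<theta> r (\<alpha> + \<gamma>) \<le> \<theta> (A * r) \<alpha> * \<theta> (A * r) \<gamma>"
    and supmult: "0 < r \<Longrightarrow> \<theta> (r / A) \<alpha> * \<theta> (r / A) \<gamma> \<le> \<theta> r (\<alpha> + \<gamma>)"
    and growth: "1 \<le> K \<Longrightarrow> 0 < r \<Longrightarrow> \<exists>r'>0. \<exists>C>0. \<forall>\<alpha>. K ^ mlen \<alpha> * \<theta> r \<alpha> \<le> C * \<theta> r' \<alpha>"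
begin

lemma weight_boundE:
  assumes "weight_bound \<theta> r2 r1 c" "0 < r1"
  obtains C where "0 \<le> C" "\<And>\<alpha> \<beta>. cmod (c (\<alpha>, \<beta>)) * \<theta> r2 \<alpha> \<le> C * \<theta> r1 \<beta>"
proof -
  from assms(1) obtain C where C: "\<And>\<alpha> \<beta>. cmod (c (\<alpha>, \<beta>)) * \<theta> r2 \<alpha> \<le> C * \<theta> r1 \<beta>"
    by (auto simp: weight_bound_def)
  have "C * \<theta> r1 \<beta> \<le> max C 0 * \<theta> r1 \<beta>" for \<beta>
    using pos[OF assms(2), of \<beta>] by (intro mult_right_mono) auto
  then show ?thesis
    using C by (intro that[of "max C 0"]) (auto intro: order_trans)
qed

lemma weight_bound_mono:
  assumes b: "weight_bound \<theta> r2 r1 c" and r: "0 < r2'" "r2' \<le> r2" "0 < r1" "r1 \<le> r1'"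
  shows "weight_bound \<theta> r2' r1' c"
proof -
  obtain C where C: "0 \<le> C" "\<And>\<alpha> \<beta>. cmod (c (\<alpha>, \<beta>)) * \<theta> r2 \<alpha> \<le> C * \<theta> r1 \<beta>"
    using weight_boundE[OF b \<open>0 < r1\<close>] by metis
  have "cmod (c (\<alpha>, \<beta>)) * \<theta> r2' \<alpha> \<le> C * \<theta> r1' \<beta>" for \<alpha> \<beta>
  proof -
    have "cmod (c (\<alpha>, \<beta>)) * \<theta> r2' \<alpha> \<le> cmod (c (\<alpha>, \<beta>)) * \<theta> r2 \<alpha>"
      using mono r by (intro mult_left_mono) auto
    also have "\<dots> \<le> C * \<theta> r1 \<beta>" by (rule C)
    also have "\<dots> \<le> C * \<theta> r1' \<beta>"
      using mono r C(1) by (intro mult_left_mono) auto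
    finally show ?thesis .
  qed
  then show ?thesis by (auto simp: weight_bound_def)
qed

lemma weight_bound_add:
  assumes "weight_bound \<theta> r2 r1 c" "weight_bound \<theta> r2 r1 c'" "0 < r2"
  shows "weight_bound \<theta> r2 r1 (c + c')"
proof -
  from assms obtain C C' where
    "\<And>\<alpha> \<beta>. cmod (c (\<alpha>, \<beta>)) * \<theta> r2 \<alpha> \<le> C * \<theta> r1 \<beta>"
    "\<And>\<alpha> \<beta>. cmod (c' (\<alpha>, \<beta>)) * \<theta> r2 \<alpha> \<le> C' * \<theta> r1 \<beta>"
    by (auto simp: weight_bound_def)
  moreover have "cmod ((c + c') (\<alpha>, \<beta>)) * \<theta> r2 \<alpha>
      \<le> (cmod (c (\<alpha>, \<beta>)) + cmod (c' (\<alpha>, \<beta>))) * \<theta> r2 \<alpha>" for \<alpha> \<beta>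
    using pos[OF \<open>0 < r2\<close>, of \<alpha>] by (intro mult_right_mono) (auto intro: norm_triangle_ineq)
  ultimately have "cmod ((c + c') (\<alpha>, \<beta>)) * \<theta> r2 \<alpha> \<le> (C + C') * \<theta> r1 \<beta>" for \<alpha> \<beta>
    unfolding distrib_right by (meson add_mono order_trans)
  then show ?thesis unfolding weight_bound_def by blast
qed

lemma weight_bound_scale:
  assumes "weight_bound \<theta> r2 r1 c"
  shows "weight_bound \<theta> r2 r1 (scale_series k c)"
proof -
  from assms obtain C where C: "\<And>\<alpha> \<beta>. cmod (c (\<alpha>, \<beta>)) * \<theta> r2 \<alpha> \<le> C * \<theta> r1 \<beta>"
    by (auto simp: weight_bound_def)
  have "cmod (scale_series k c (\<alpha>, \<beta>)) * \<theta> r2 \<alpha> \<le> (cmod k * C) * \<theta> r1 \<beta>" for \<alpha> \<beta>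
    using mult_left_mono[OF C[of \<alpha> \<beta>], of "cmod k"]
    by (simp add: scale_series_def norm_mult mult.assoc)
  then show ?thesis unfolding weight_bound_def by blast
qed

lemma weight_bound_0: "weight_bound \<theta> r2 r1 0"
  unfolding weight_bound_def by (rule exI[of _ 0]) simp

text \<open>A loss of \<open>8\<^bsup>|\<alpha>| + |\<beta>| + |\<gamma>|\<^esup>\<close> in the weights absorbs \<open>2\<^bsup>|\<gamma>|\<^esup>\<close> and the square root of the
  binomials, which is at most \<open>2\<^bsup>|\<alpha>| + |\<beta>| + |\<gamma>|\<^esup>\<close>, and leaves a convergent geometric series in \<open>\<gamma>\<close>.\<close>

lemma shift_term_le:
  assumes c: "\<And>\<alpha> \<beta>. cmod (c (\<alpha>, \<beta>)) * \<theta> r2 \<alpha> \<le> C * \<theta> r1 \<beta>" and "0 \<le> C"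
    and h1: "\<And>\<gamma>. 8 ^ mlen \<gamma> * \<theta> (A * r1) \<gamma> \<le> C1 * \<theta> (r2 / A) \<gamma>" and "0 \<le> C1"
    and h2: "\<And>\<beta>. 8 ^ mlen \<beta> * \<theta> (A * r1) \<beta> \<le> C2 * \<theta> r1' \<beta>" and "0 \<le> C2"
    and h3: "\<And>\<alpha>. 8 ^ mlen \<alpha> * \<theta> r2' \<alpha> \<le> C3 * \<theta> (r2 / A) \<alpha>" and "0 \<le> C3"
    and r: "0 < r1" "0 < r2" "0 < r1'" "0 < r2'"
  shows "2 ^ mlen \<gamma> * shift_weight \<alpha> \<beta> \<gamma> * cmod (c (\<alpha> + \<gamma>, \<beta> + \<gamma>)) * \<theta> r2' \<alpha>
    \<le> (C * C1 * C2 * C3 * \<theta> r1' \<beta>) * (1 / 2) ^ mlen \<gamma>"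
proof -
  define x where "x = cmod (c (\<alpha> + \<gamma>, \<beta> + \<gamma>))"
  have x: "0 \<le> x" by (simp add: x_def)
  have A: "0 < A" using A_ge_1 by simp
  have p: "0 < \<theta> (r2 / A) \<alpha>" "0 < \<theta> (r2 / A) \<gamma>" "0 < \<theta> (A * r1) \<beta>" "0 < \<theta> (A * r1) \<gamma>"
    "0 < \<theta> r1' \<beta>" "0 < \<theta> r2' \<alpha>"
    using r A by (auto intro!: pos)
  have "x * (\<theta> (r2 / A) \<alpha> * \<theta> (r2 / A) \<gamma>) \<le> x * \<theta> r2 (\<alpha> + \<gamma>)"
    using supmult r x by (intro mult_left_mono) auto
  also have "\<dots> \<le> C * \<theta> r1 (\<beta> + \<gamma>)"
    unfolding x_def by (rule c)
  also have "\<dots> \<le> C * (\<theta> (A * r1) \<beta> * \<theta> (A * r1) \<gamma>)"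
    using submult r \<open>0 \<le> C\<close> by (intro mult_left_mono) auto
  finally have "8 ^ mlen \<gamma> * (x * (\<theta> (r2 / A) \<alpha> * \<theta> (r2 / A) \<gamma>))
      \<le> 8 ^ mlen \<gamma> * (C * (\<theta> (A * r1) \<beta> * \<theta> (A * r1) \<gamma>))"
    by (rule mult_left_mono) simp
  also have "\<dots> = (C * \<theta> (A * r1) \<beta>) * (8 ^ mlen \<gamma> * \<theta> (A * r1) \<gamma>)"
    by (simp add: algebra_simps)
  also have "\<dots> \<le> (C * \<theta> (A * r1) \<beta>) * (C1 * \<theta> (r2 / A) \<gamma>)"
    using h1 \<open>0 \<le> C\<close> p by (intro mult_left_mono) auto
  finally have "(8 ^ mlen \<gamma> * x * \<theta> (r2 / A) \<alpha>) * \<theta> (r2 / A) \<gamma>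
      \<le> (C * C1 * \<theta> (A * r1) \<beta>) * \<theta> (r2 / A) \<gamma>"
    by (simp add: algebra_simps)
  \<comment> \<open>The growth of the coefficients in \<gamma> is now paid for: \<open>h1\<close>
    compares the r1-weight with the r2-weight at \<gamma>, and the latter cancels.\<close>
  then have a: "8 ^ mlen \<gamma> * x * \<theta> (r2 / A) \<alpha> \<le> C * C1 * \<theta> (A * r1) \<beta>"
    using p(2) by (rule mult_right_le_imp_le)
  have "8 ^ mlen \<beta> * 8 ^ mlen \<gamma> * x * (8 ^ mlen \<alpha> * \<theta> r2' \<alpha>)
      \<le> 8 ^ mlen \<beta> * 8 ^ mlen \<gamma> * x * (C3 * \<theta> (r2 / A) \<alpha>)"
    using h3 x by (intro mult_left_mono) auto
  also have "\<dots> = (8 ^ mlen \<beta> * C3) * (8 ^ mlen \<gamma> * x * \<theta> (r2 / A) \<alpha>)"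
    by (simp add: algebra_simps)
  also have "\<dots> \<le> (8 ^ mlen \<beta> * C3) * (C * C1 * \<theta> (A * r1) \<beta>)"
    using a \<open>0 \<le> C3\<close> by (intro mult_left_mono) auto
  also have "\<dots> = (C * C1 * C3) * (8 ^ mlen \<beta> * \<theta> (A * r1) \<beta>)"
    by (simp add: algebra_simps)
  also have "\<dots> \<le> (C * C1 * C3) * (C2 * \<theta> r1' \<beta>)"
    using h2 \<open>0 \<le> C\<close> \<open>0 \<le> C1\<close> \<open>0 \<le> C3\<close> by (intro mult_left_mono) auto
  finally have b: "8 ^ mlen \<beta> * 8 ^ mlen \<gamma> * x * (8 ^ mlen \<alpha> * \<theta> r2' \<alpha>)
      \<le> C * C1 * C2 * C3 * \<theta> r1' \<beta>"
    by (simp add: algebra_simps)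
  have "2 ^ mlen \<gamma> * shift_weight \<alpha> \<beta> \<gamma> \<le> 2 ^ mlen \<gamma> * 2 ^ (mlen \<alpha> + mlen \<beta> + mlen \<gamma>)"
    using shift_weight_le by (intro mult_left_mono) auto
  \<comment> \<open>For \<gamma> the base 8 is used up exactly, two factors 2 being spent and one
    left for the ratio 1/2; for \<alpha> and \<beta> it is generous, so that one base serves all
    three.\<close>
  also have "\<dots> \<le> 2 ^ (3 * mlen \<alpha> + 3 * mlen \<beta> + 2 * mlen \<gamma>)"
    unfolding power_add[symmetric] by (rule power_increasing) auto
  also have "\<dots> = 8 ^ mlen \<beta> * 8 ^ mlen \<gamma> * 8 ^ mlen \<alpha> * (1 / 2) ^ mlen \<gamma>"
  proof -
    have "(8::real) ^ mlen \<gamma> * (1 / 2) ^ mlen \<gamma> = 4 ^ mlen \<gamma>"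
      unfolding power_mult_distrib[symmetric] by simp
    then show ?thesis
      by (simp add: power_add power_mult mult.assoc mult.left_commute)
  qed
  finally have "2 ^ mlen \<gamma> * shift_weight \<alpha> \<beta> \<gamma> * (x * \<theta> r2' \<alpha>)
      \<le> 8 ^ mlen \<beta> * 8 ^ mlen \<gamma> * 8 ^ mlen \<alpha> * (1 / 2) ^ mlen \<gamma> * (x * \<theta> r2' \<alpha>)"
    using x p by (intro mult_right_mono) auto
  also have "\<dots> = (8 ^ mlen \<beta> * 8 ^ mlen \<gamma> * x * (8 ^ mlen \<alpha> * \<theta> r2' \<alpha>)) * (1 / 2) ^ mlen \<gamma>"
    by (simp add: algebra_simps)
  also have "\<dots> \<le> (C * C1 * C2 * C3 * \<theta> r1' \<beta>) * (1 / 2) ^ mlen \<gamma>"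
    using b by (rule mult_right_mono) simp
  finally show ?thesis by (simp add: x_def mult.assoc)
qed

text \<open>Keeping r and r' free allows both quantifications: given r, find r' (always possible, by
  \<open>growth\<close>), or given r', find r (a property of particular weights).\<close>

definition dominated :: "real \<Rightarrow> real \<Rightarrow> real \<Rightarrow> bool" where
  "dominated K r r' \<longleftrightarrow> (\<exists>C\<ge>0. \<forall>\<alpha>. K ^ mlen \<alpha> * \<theta> r \<alpha> \<le> C * \<theta> r' \<alpha>)"

lemma dominated_mono:
  assumes "dominated K r r'" "0 < q" "q \<le> r" "0 < r'" "r' \<le> q'" "0 \<le> K"
  shows "dominated K q q'"
proof -
  obtain C where C: "0 \<le> C" "\<And>\<alpha>. K ^ mlen \<alpha> * \<theta> r \<alpha> \<le> C * \<theta> r' \<alpha>"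
    using assms(1) by (auto simp: dominated_def)
  have "K ^ mlen \<alpha> * \<theta> q \<alpha> \<le> C * \<theta> q' \<alpha>" for \<alpha>
  proof -
    have "K ^ mlen \<alpha> * \<theta> q \<alpha> \<le> K ^ mlen \<alpha> * \<theta> r \<alpha>"
      using assms mono by (intro mult_left_mono) auto
    also have "\<dots> \<le> C * \<theta> r' \<alpha>" by (rule C)
    also have "\<dots> \<le> C * \<theta> q' \<alpha>"
      using assms mono C by (intro mult_left_mono) auto
    finally show ?thesis .
  qed
  with C(1) show ?thesis by (auto simp: dominated_def)
qed

lemma ex_dominated_above: "1 \<le> K \<Longrightarrow> 0 < r \<Longrightarrow> \<exists>r'>0. dominated K r r'"
  using growth[of K r] unfolding dominated_def by (meson less_imp_le)

text \<open>The three dominations pay, in this order, for convergence in \<gamma>, for the growth in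
  \<beta> and for the decay in \<alpha>. All four parameters remain free, so the estimate serves
  both orders of the limits.\<close>

lemma shift_exp_weight_bound:
  assumes b: "weight_bound \<theta> r2 r1 c"
    and d: "dominated 8 (A * r1) (r2 / A)" "dominated 8 (A * r1) r1'" "dominated 8 r2' (r2 / A)"
    and r: "0 < r1" "0 < r2" "0 < r1'" "0 < r2'"
  shows "shift_summable c" and "cmod t \<le> 1 \<Longrightarrow> weight_bound \<theta> r2' r1' (shift_exp t c)"
proof -
  obtain C where C: "0 \<le> C" "\<And>\<alpha> \<beta>. cmod (c (\<alpha>, \<beta>)) * \<theta> r2 \<alpha> \<le> C * \<theta> r1 \<beta>"
    using weight_boundE[OF b \<open>0 < r1\<close>] by metis
  obtain C1 C2 C3 where K: "0 \<le> C1" "0 \<le> C2" "0 \<le> C3"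
    "\<And>\<gamma>. 8 ^ mlen \<gamma> * \<theta> (A * r1) \<gamma> \<le> C1 * \<theta> (r2 / A) \<gamma>"
    "\<And>\<beta>. 8 ^ mlen \<beta> * \<theta> (A * r1) \<beta> \<le> C2 * \<theta> r1' \<beta>"
    "\<And>\<alpha>. 8 ^ mlen \<alpha> * \<theta> r2' \<alpha> \<le> C3 * \<theta> (r2 / A) \<alpha>"
    using d unfolding dominated_def by metis
  define M where "M = C * C1 * C2 * C3"
  define u where "u \<alpha> \<beta> \<gamma> = 2 ^ mlen \<gamma> * shift_weight \<alpha> \<beta> \<gamma> * cmod (c (\<alpha> + \<gamma>, \<beta> + \<gamma>))" for \<alpha> \<beta> \<gamma>
  define v where "v \<alpha> \<beta> \<gamma> = M * \<theta> r1' \<beta> / \<theta> r2' \<alpha> * (1 / 2) ^ mlen \<gamma>" for \<alpha> \<beta> \<gamma> :: "nat ^ 'd"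
  have uv: "u \<alpha> \<beta> \<gamma> \<le> v \<alpha> \<beta> \<gamma>" for \<alpha> \<beta> \<gamma>
    using shift_term_le[OF C(2,1) K(4,1,5,2,6,3) r, of \<gamma> \<alpha> \<beta>] pos[OF \<open>0 < r2'\<close>, of \<alpha>]
    by (simp add: u_def v_def M_def field_simps)
  have u0: "0 \<le> u \<alpha> \<beta> \<gamma>" for \<alpha> \<beta> \<gamma>
    by (simp add: u_def shift_weight_nonneg)
  have vsum: "v \<alpha> \<beta> summable_on UNIV" for \<alpha> \<beta>
    unfolding v_def by (intro summable_on_cmult_right summable_on_power_mlen) auto
  have usum: "u \<alpha> \<beta> summable_on UNIV" for \<alpha> \<beta>
    by (rule summable_on_comparison_test[OF vsum]) (use uv u0 in auto)
  then show sm: "shift_summable c"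
    by (simp add: shift_summable_def u_def[abs_def])
  assume t: "cmod t \<le> 1"
  define S :: real where "S = (\<Sum>\<^sub>\<infinity>\<gamma> :: nat ^ 'd. (1 / 2) ^ mlen \<gamma>)"
  have "cmod (shift_exp t c (\<alpha>, \<beta>)) * \<theta> r2' \<alpha> \<le> (M * S) * \<theta> r1' \<beta>" for \<alpha> \<beta>
  proof -
    let ?f = "\<lambda>\<gamma>. t ^ mlen \<gamma> * of_real (shift_weight \<alpha> \<beta> \<gamma>) * c (\<alpha> + \<gamma>, \<beta> + \<gamma>)"
    have fu: "cmod (?f \<gamma>) \<le> u \<alpha> \<beta> \<gamma>" for \<gamma>
    proof -
      have "cmod t ^ mlen \<gamma> \<le> 2 ^ mlen \<gamma>" using t by (intro power_mono) auto
      then show ?thesis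
        unfolding u_def norm_mult norm_power norm_of_real
        by (intro mult_mono) (auto simp: shift_weight_nonneg)
    qed
    have fsum: "(\<lambda>\<gamma>. cmod (?f \<gamma>)) summable_on UNIV"
      by (rule summable_on_comparison_test[OF usum]) (use fu in auto)
    have "cmod (shift_exp t c (\<alpha>, \<beta>)) \<le> (\<Sum>\<^sub>\<infinity>\<gamma>. cmod (?f \<gamma>))"
      unfolding shift_exp_def prod.case by (rule norm_infsum_bound[OF fsum])
    also have "\<dots> \<le> infsum (v \<alpha> \<beta>) UNIV"
      by (rule infsum_mono[OF fsum vsum]) (meson fu uv order_trans)
    also have "\<dots> = M * \<theta> r1' \<beta> / \<theta> r2' \<alpha> * S"
      unfolding v_def S_def by (rule infsum_cmult_right')
    finally show ?thesis
      using pos[OF \<open>0 < r2'\<close>, of \<alpha>] by (simp add: field_simps)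
  qed
  then show "weight_bound \<theta> r2' r1' (shift_exp t c)"
    unfolding weight_bound_def by blast
qed

text \<open>\<open>space0\<close> and \<open>space1\<close> are the sup-norm forms of
  \<open>ell_C0\<close> and \<open>ell_C\<close>; they differ in the order of the
  quantifiers.\<close>

definition space0 :: "((nat ^ 'd) \<times> (nat ^ 'd) \<Rightarrow> complex) set" where
  "space0 = {c. \<exists>r1>0. \<forall>r2>0. weight_bound \<theta> r2 r1 c}"

definition space1 :: "((nat ^ 'd) \<times> (nat ^ 'd) \<Rightarrow> complex) set" where
  "space1 = {c. \<exists>r2>0. \<forall>r1>0. weight_bound \<theta> r2 r1 c}"

lemma subspace_space0: "module.subspace scale_series space0"
proof (subst module.subspace_def[OF module_scale_series], intro conjI ballI allI)
  show "0 \<in> space0" by (auto simp: space0_def weight_bound_0 intro: exI[of _ 1])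
next
  fix c c' assume "c \<in> space0" "c' \<in> space0"
  then obtain r r' where r: "0 < r" "\<And>r2. 0 < r2 \<Longrightarrow> weight_bound \<theta> r2 r c"
    "0 < r'" "\<And>r2. 0 < r2 \<Longrightarrow> weight_bound \<theta> r2 r' c'"
    by (auto simp: space0_def)
  \<comment> \<open>Raising r1 weakens the bound, so the union is directed and two elements share a
    parameter.\<close>
  have "weight_bound \<theta> r2 (max r r') (c + c')" if r2: "0 < r2" for r2
    by (intro weight_bound_add weight_bound_mono[OF r(2)[OF r2] r2 order_refl r(1)]
        weight_bound_mono[OF r(4)[OF r2] r2 order_refl r(3)] r2) auto
  with r show "c + c' \<in> space0" by (auto simp: space0_def intro!: exI[of _ "max r r'"])
qed (auto simp: space0_def intro: weight_bound_scale)

lemma subspace_space1: "module.subspace scale_series space1"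
proof (subst module.subspace_def[OF module_scale_series], intro conjI ballI allI)
  show "0 \<in> space1" by (auto simp: space1_def weight_bound_0 intro: exI[of _ 1])
next
  fix c c' assume "c \<in> space1" "c' \<in> space1"
  then obtain r r' where r: "0 < r" "\<And>r1. 0 < r1 \<Longrightarrow> weight_bound \<theta> r r1 c"
    "0 < r'" "\<And>r1. 0 < r1 \<Longrightarrow> weight_bound \<theta> r' r1 c'"
    by (auto simp: space1_def)
  have "weight_bound \<theta> (min r r') r1 (c + c')" if r1: "0 < r1" for r1
    by (intro weight_bound_add weight_bound_mono[OF r(2)[OF r1] _ _ r1 order_refl]
        weight_bound_mono[OF r(4)[OF r1] _ _ r1 order_refl]) (use r in auto)
  with r show "c + c' \<in> space1" by (auto simp: space1_def intro!: exI[of _ "min r r'"])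
qed (auto simp: space1_def intro: weight_bound_scale)

text \<open>A single r1' must work for all r2'. It is found above \<open>A * r1\<close> before r2'
  is given; afterwards r2 may be as large as r2' requires. Parameters are only ever raised.\<close>

lemma shift_stable_space0: "shift_stable space0"
proof -
  have stable: "shift_summable c \<and> shift_exp t c \<in> space0" if c: "c \<in> space0" and t: "cmod t \<le> 1" for c t
  proof -
    have A: "0 < A" using A_ge_1 by simp
    obtain r1 where r1: "0 < r1" "\<And>r2. 0 < r2 \<Longrightarrow> weight_bound \<theta> r2 r1 c"
      using c by (auto simp: space0_def)
    then have Ar1: "0 < A * r1" using A by simp
    obtain r1' where r1': "0 < r1'" "dominated 8 (A * r1) r1'"
      using ex_dominated_above[OF _ Ar1, of 8] by auto
    have step: "shift_summable c \<and> weight_bound \<theta> r2' r1' (shift_exp t c)" if r2': "0 < r2'" for r2'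
    proof -
      obtain \<rho> where \<rho>: "0 < \<rho>" "dominated 8 r2' \<rho>"
        using ex_dominated_above[OF _ r2', of 8] by auto
      \<comment> \<open>The maximum meets both demands on \<open>r2 / A\<close>: beyond r1' for
        convergence, beyond \<rho> for the decay in \<alpha>.\<close>
      define r2 where "r2 = A * max \<rho> r1'"
      have r2: "0 < r2" "r2 / A = max \<rho> r1'" using A \<rho> by (auto simp: r2_def)
      have "dominated 8 (A * r1) (r2 / A)" "dominated 8 r2' (r2 / A)"
        unfolding r2(2) using \<rho> r1' r2' Ar1 by (auto intro: dominated_mono)
      then show ?thesis
        using shift_exp_weight_bound[OF r1(2)[OF r2(1)] _ r1'(2) _ r1(1) r2(1) r1'(1) r2'] t by blast
    qed
    then have "shift_exp t c \<in> space0"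
      unfolding space0_def using r1' by blast
    with step[of 1] show ?thesis by simp
  qed
  then show ?thesis
    unfolding shift_stable_def using subspace_space0 stable[of _ 1] stable[of _ "- 1"] by simp
qed

text \<open>Here r2' is fixed first, below \<open>r2 / A\<close>, and r1 is then taken small in
  terms of r1'; both choices lower a parameter, whence the hypothesis \<open>below\<close>.\<close>

lemma shift_stable_space1:
  assumes below: "\<And>K r'. 1 \<le> K \<Longrightarrow> 0 < r' \<Longrightarrow> \<exists>r>0. dominated K r r'"
  shows "shift_stable space1"
proof -
  have stable: "shift_summable c \<and> shift_exp t c \<in> space1" if c: "c \<in> space1" and t: "cmod t \<le> 1" for c t
  proof -
    have A: "0 < A" using A_ge_1 by simp
    obtain r2 where r2: "0 < r2" "\<And>r1. 0 < r1 \<Longrightarrow> weight_bound \<theta> r2 r1 c"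
      using c by (auto simp: space1_def)
    then have Ar2: "0 < r2 / A" using A by simp
    obtain r2' where r2': "0 < r2'" "dominated 8 r2' (r2 / A)"
      using below[OF _ Ar2, of 8] by auto
    have step: "shift_summable c \<and> weight_bound \<theta> r2' r1' (shift_exp t c)" if r1': "0 < r1'" for r1'
    proof -
      obtain \<rho> where \<rho>: "0 < \<rho>" "dominated 8 \<rho> r1'"
        using below[OF _ r1', of 8] by auto
      define r1 where "r1 = min \<rho> r2' / A"
      have r1: "0 < r1" "A * r1 = min \<rho> r2'" using A \<rho> r2' by (auto simp: r1_def)
      have "dominated 8 (A * r1) (r2 / A)" "dominated 8 (A * r1) r1'"
        unfolding r1(2) using \<rho> r2' r1' Ar2 by (auto intro: dominated_mono)
      then show ?thesis
        using shift_exp_weight_bound[OF r2(2)[OF r1(1)] _ _ r2'(2) r1(1) r2(1) r1' r2'(1)] t by blast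
    qed
    then have "shift_exp t c \<in> space1"
      unfolding space1_def using r2' by blast
    with step[of 1] show ?thesis by simp
  qed
  then show ?thesis
    unfolding shift_stable_def using subspace_space1 stable[of _ 1] stable[of _ "- 1"] by simp
qed

end

section \<open>Sequence spaces and their independence of p\<close>

lemma epowr_ennreal: "0 \<le> x \<Longrightarrow> epowr (ennreal x) q = ennreal (x powr q)"
  by (simp add: epowr_def)

lemma epowr_mono: "x \<le> y \<Longrightarrow> 0 \<le> q \<Longrightarrow> epowr x q \<le> epowr y q"
  by (cases x; cases y) (auto simp: epowr_def top_unique intro!: ennreal_leI powr_mono2)

text \<open>A single term of a nonnegative series is at most its sum, so for every p, also below 1,
  the space embeds into the bounded sequences.\<close>

lemma lp_norm_finiteD:
  assumes "lp_norm p f < \<infinity>" "0 < p"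
  obtains C where "0 \<le> C" "\<And>i. f i \<le> ennreal C"
proof (cases "p = \<infinity>")
  case True
  then have S: "(SUP i. f i) < top" using assms by (simp add: lp_norm_def)
  have "f i \<le> ennreal (enn2real (SUP i. f i))" for i
    using S by (simp add: SUP_upper)
  then show ?thesis by (rule that[OF enn2real_nonneg])
next
  case False
  define P where "P = enn2real p"
  have P: "0 < P" using False assms(2) by (simp add: P_def enn2real_positive_iff less_top)
  define S where "S = (\<Sum>\<^sub>\<infinity>i. epowr (f i) P)"
  have S: "S < top"
  proof (rule ccontr)
    assume "\<not> S < top"
    then have "S = top" by (simp add: less_top[symmetric])
    then have "lp_norm p f = top"
      using False unfolding lp_norm_def P_def[symmetric] S_def[symmetric] by (simp add: epowr_def[of top])
    with assms(1) show False by simp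
  qed
  have "f i \<le> ennreal (enn2real S powr (1 / P))" for i
  proof -
    have le: "epowr (f i) P \<le> S"
      unfolding S_def using infsum_mono_neutral[of "\<lambda>i. epowr (f i) P" "{i}" "\<lambda>i. epowr (f i) P" UNIV]
      by (simp add: nonneg_summable_on_complete)
    with S have top: "f i \<noteq> top" by (auto simp: epowr_def)
    then obtain x where x: "f i = ennreal x" "0 \<le> x" by (cases "f i") auto
    have "ennreal (x powr P) \<le> ennreal (enn2real S)"
      using le S x by (simp add: epowr_ennreal)
    then have "x powr P \<le> enn2real S" by (simp add: ennreal_le_iff)
    then have "(x powr P) powr (1 / P) \<le> enn2real S powr (1 / P)"
      using P by (intro powr_mono2) auto
    then show ?thesis using x P by (simp add: powr_powr ennreal_leI)
  qed
  then show ?thesis by (rule that[rotated]) simp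
qed

text \<open>All positive powers of the majorant are required to be summable because p may be
  arbitrarily small; geometric majorants have this property. The bound B covers p =
  \<infinity>.\<close>

lemma lp_norm_finiteI:
  fixes g :: "'i \<Rightarrow> real"
  assumes fg: "\<And>i. f i \<le> ennreal (g i)" and g: "\<And>i. 0 \<le> g i" "\<And>i. g i \<le> B"
    and sum: "\<And>q. 0 < q \<Longrightarrow> (\<lambda>i. g i powr q) summable_on UNIV" and p: "0 < p"
  shows "lp_norm p f < \<infinity>"
proof (cases "p = \<infinity>")
  case True
  have "(SUP i. f i) \<le> ennreal B"
    by (rule SUP_least) (meson fg g(2) ennreal_leI order_trans)
  then have "(SUP i. f i) < top" by (rule le_less_trans) simp
  then show ?thesis using True by (simp add: lp_norm_def)
next
  case False
  define P where "P = enn2real p"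
  have P: "0 < P" using False p by (simp add: P_def enn2real_positive_iff less_top)
  have "(\<Sum>\<^sub>\<infinity>i. epowr (f i) P) \<le> (\<Sum>\<^sub>\<infinity>i. ennreal (g i powr P))"
  proof (rule infsum_mono)
    fix i
    show "epowr (f i) P \<le> ennreal (g i powr P)"
      using epowr_mono[OF fg, of P i] P g by (simp add: epowr_ennreal)
  qed (auto intro: nonneg_summable_on_complete)
  \<comment> \<open>The extended sum is a supremum of finite sums, each of which the real infinite
    sum bounds.\<close>
  also have "\<dots> = (SUP F\<in>{F. finite F \<and> F \<subseteq> UNIV}. ennreal (\<Sum>i\<in>F. g i powr P))"
    by (subst nonneg_infsum_complete) simp_all
  also have "\<dots> \<le> ennreal (\<Sum>\<^sub>\<infinity>i. g i powr P)"
    by (rule SUP_least) (auto intro!: ennreal_leI finite_sum_le_infsum sum[OF P])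
  finally have "(\<Sum>\<^sub>\<infinity>i. epowr (f i) P) < top"
    by (auto simp: less_top[symmetric] top_unique)
  then show ?thesis
    using False by (simp add: lp_norm_def P_def[symmetric] epowr_def)
qed

lemma lp_norm_swap: "lp_norm p (\<lambda>i. f (prod.swap i)) = lp_norm p f"
proof -
  have bij: "bij_betw prod.swap UNIV UNIV" by (simp add: bij_betw_def)
  have "(SUP i. f (prod.swap i)) = (SUP i. f i)"
    using bij image_image[of f prod.swap UNIV] by (simp add: bij_betw_def)
  then show ?thesis
    using infsum_reindex_bij_betw[OF bij, of "\<lambda>i. epowr (f i) (enn2real p)"]
    by (simp add: lp_norm_def)
qed

text \<open>The starred weight at (\<alpha>, \<beta>) is the unstarred one at (\<beta>, \<alpha>)
  with the parameters exchanged, so the inductive limit of each starred space matches that of its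
  unstarred partner.\<close>

lemma ell_omega_star: "ell p (omega_star s r2 r1) = {c. swap_series c \<in> ell p (omega s r1 r2)}"
proof -
  have "lp_norm p (\<lambda>i. ennreal (cmod (c i)) * omega_star s r2 r1 i)
      = lp_norm p (\<lambda>i. ennreal (cmod (swap_series c i)) * omega s r1 r2 i)"
    for c :: "(nat ^ 'a) \<times> (nat ^ 'a) \<Rightarrow> complex"
    using lp_norm_swap[of p "\<lambda>i. ennreal (cmod (c i)) * omega_star s r2 r1 i"]
    by (simp add: swap_series_def omega_star_def omega_def case_prod_unfold prod.swap_def)
  then show ?thesis by (simp add: ell_def)
qed

lemma ell_C_star_swap: "ell_C_star p s = {c. swap_series c \<in> ell_C p s}"
  by (auto simp: ell_C_star_def ell_C_def ell_omega_star)

lemma ell_C0_star_swap: "ell_C0_star p s = {c. swap_series c \<in> ell_C0 p s}"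
proof -
  have "swap_series c = (\<lambda>_. 0) \<longleftrightarrow> c = (\<lambda>_. 0)" for c :: "(nat ^ 'a) \<times> (nat ^ 'a) \<Rightarrow> complex"
    by (auto simp: swap_series_def fun_eq_iff)
  then show ?thesis
    by (auto simp: ell_C0_star_def ell_C0_def ell_omega_star zero_fun_def)
qed

lemma power_powr_swap:
  fixes x q :: real
  assumes "0 \<le> x"
  shows "(x ^ n) powr q = (x powr q) ^ n"
  by (induction n) (use assms in \<open>auto simp: powr_mult\<close>)

lemma summable_on_power_mlen_pair:
  fixes x :: real
  assumes x: "0 \<le> x" "x < 1"
  shows "(\<lambda>(\<alpha>, \<beta>). x ^ (mlen \<alpha> + mlen \<beta>)) summable_on (UNIV :: ((nat ^ 'd::finite) \<times> (nat ^ 'd)) set)"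
proof -
  have nonneg: "0 \<le> (\<Sum>\<^sub>\<infinity>\<beta> :: nat ^ 'd. x ^ mlen \<beta>)"
    by (rule infsum_nonneg) (use x in auto)
  have "(\<lambda>p :: (nat ^ 'd) \<times> (nat ^ 'd). norm (x ^ mlen (fst p) * x ^ mlen (snd p))) summable_on (UNIV \<times> UNIV)"
    by (rule iffD2[OF Infinite_Sum.abs_summable_on_Sigma_iff])
       (use x nonneg in \<open>auto simp: infsum_cmult_right' intro!: summable_on_cmult_right summable_on_cmult_left
          summable_on_power_mlen\<close>)
  then show ?thesis
    using x by (simp add: case_prod_unfold power_add)
qed

section \<open>Identification of the limits with their sup-norm forms\<close>

context weight_family
begin

context
  fixes s :: rflat
  assumes theta_eq: "\<And>r (\<alpha> :: nat ^ 'd). 0 < r \<Longrightarrow> theta r s \<alpha> = ennreal (\<theta> r \<alpha>)"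
begin

lemma omega_eq: "0 < r1 \<Longrightarrow> 0 < r2 \<Longrightarrow> omega s r2 r1 (\<alpha>, \<beta>) = ennreal (\<theta> r2 \<alpha> / \<theta> r1 \<beta>)"
  using pos[of r1 \<beta>] pos[of r2 \<alpha>] by (simp add: omega_def theta_eq divide_ennreal)

lemma weight_bound_of_ell:
  assumes c: "c \<in> ell p (omega s r2 r1)" and r: "0 < r1" "0 < r2" and "0 < p"
  shows "weight_bound \<theta> r2 r1 c"
proof -
  have "lp_norm p (\<lambda>i. ennreal (cmod (c i)) * omega s r2 r1 i) < \<infinity>"
    using c by (simp add: ell_def)
  then obtain C where C: "0 \<le> C" "\<And>i. ennreal (cmod (c i)) * omega s r2 r1 i \<le> ennreal C"
    using \<open>0 < p\<close> by (rule lp_norm_finiteD) (rule that)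
  have "cmod (c (\<alpha>, \<beta>)) * \<theta> r2 \<alpha> \<le> C * \<theta> r1 \<beta>" for \<alpha> \<beta>
    using C(2)[of "(\<alpha>, \<beta>)"] C(1) r pos[OF r(1), of \<beta>] pos[OF r(2), of \<alpha>]
    by (simp add: omega_eq ennreal_mult[symmetric] ennreal_le_iff field_simps)
  then show ?thesis by (auto simp: weight_bound_def)
qed

text \<open>The converse costs a change of both parameters: the gain of 2^(|\<alpha>| + |\<beta>|)
  leaves a geometric majorant, which lies in every \<open>ell\<close> space. The limits absorb this
  change.\<close>

lemma ell_of_weight_bound:
  assumes b: "weight_bound \<theta> r2 r1 c" and d: "dominated 2 r1 r1'" "dominated 2 r2' r2"
    and r: "0 < r1" "0 < r2" "0 < r1'" "0 < r2'" and "0 < p"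
  shows "c \<in> ell p (omega s r2' r1')"
proof -
  obtain C where C: "0 \<le> C" "\<And>\<alpha> \<beta>. cmod (c (\<alpha>, \<beta>)) * \<theta> r2 \<alpha> \<le> C * \<theta> r1 \<beta>"
    using weight_boundE[OF b \<open>0 < r1\<close>] by metis
  obtain C1 C2 where K: "0 \<le> C1" "0 \<le> C2"
    "\<And>\<beta>. 2 ^ mlen \<beta> * \<theta> r1 \<beta> \<le> C1 * \<theta> r1' \<beta>"
    "\<And>\<alpha>. 2 ^ mlen \<alpha> * \<theta> r2' \<alpha> \<le> C2 * \<theta> r2 \<alpha>"
    using d unfolding dominated_def by metis
  define M where "M = C * C1 * C2"
  have M: "0 \<le> M" using C K by (simp add: M_def)
  define g where "g = (\<lambda>(\<alpha> :: nat ^ 'd, \<beta> :: nat ^ 'd). M * (1 / 2) ^ (mlen \<alpha> + mlen \<beta>))"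
  have g0: "0 \<le> g i" for i using M by (simp add: g_def split: prod.split)
  have "lp_norm p (\<lambda>i. ennreal (cmod (c i)) * omega s r2' r1' i) < \<infinity>"
  proof (rule lp_norm_finiteI[where g = g and B = M])
    fix i :: "(nat ^ 'd) \<times> (nat ^ 'd)"
    obtain \<alpha> \<beta> where i: "i = (\<alpha>, \<beta>)" by (cases i)
    let ?x = "cmod (c (\<alpha>, \<beta>))"
    have "2 ^ mlen \<beta> * ?x * (2 ^ mlen \<alpha> * \<theta> r2' \<alpha>) \<le> 2 ^ mlen \<beta> * ?x * (C2 * \<theta> r2 \<alpha>)"
      using K by (intro mult_left_mono) auto
    also have "\<dots> = (2 ^ mlen \<beta> * C2) * (?x * \<theta> r2 \<alpha>)"
      by (simp add: algebra_simps)
    also have "\<dots> \<le> (2 ^ mlen \<beta> * C2) * (C * \<theta> r1 \<beta>)"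
      using C K by (intro mult_left_mono) auto
    also have "\<dots> = (C * C2) * (2 ^ mlen \<beta> * \<theta> r1 \<beta>)"
      by (simp add: algebra_simps)
    also have "\<dots> \<le> (C * C2) * (C1 * \<theta> r1' \<beta>)"
      using C K by (intro mult_left_mono) auto
    finally have "?x * (\<theta> r2' \<alpha> / \<theta> r1' \<beta>) \<le> g i"
      using pos[OF r(3), of \<beta>] by (simp add: i g_def M_def power_add field_simps)
    then show "ennreal (cmod (c i)) * omega s r2' r1' i \<le> ennreal (g i)"
      using r pos[OF r(3), of \<beta>] pos[OF r(4), of \<alpha>]
      by (simp add: i omega_eq ennreal_mult[symmetric] ennreal_leI)
    show "g i \<le> M"
      using M by (simp add: i g_def mult_left_le power_le_one)
  next
    fix q :: real assume "0 < q"
    have "(\<lambda>i. g i powr q) = (\<lambda>i. M powr q * (case i of (\<alpha>, \<beta>) \<Rightarrow> ((1 / 2) powr q) ^ (mlen \<alpha> + mlen \<beta>)))"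
      using M by (auto simp: g_def fun_eq_iff powr_mult power_powr_swap)
    moreover have "(1 / 2 :: real) powr q < 1"
      using \<open>0 < q\<close> powr_less_mono2[of q "1/2" 1] by simp
    ultimately show "(\<lambda>i. g i powr q) summable_on UNIV"
      by (simp add: summable_on_cmult_right summable_on_power_mlen_pair)
  qed (use g0 \<open>0 < p\<close> in auto)
  then show ?thesis by (simp add: ell_def)
qed

text \<open>The limit is written out because \<open>ell_C0\<close> is defined by cases at
  \<open>Reg 0\<close>.\<close>

lemma ell_C0_eq_space0:
  assumes "0 < p"
  shows "(\<Union>r1\<in>{0<..}. \<Inter>r2\<in>{0<..}. ell p (omega s r2 r1)) = space0"
proof (intro equalityI subsetI)
  fix c :: "(nat ^ 'd) \<times> (nat ^ 'd) \<Rightarrow> complex" assume "c \<in> (\<Union>r1\<in>{0<..}. \<Inter>r2\<in>{0<..}. ell p (omega s r2 r1))"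
  then obtain r1 where r1: "0 < r1" "\<And>r2. 0 < r2 \<Longrightarrow> c \<in> ell p (omega s r2 r1)"
    by auto
  then have "weight_bound \<theta> r2 r1 c" if "0 < r2" for r2
    using that weight_bound_of_ell \<open>0 < p\<close> by blast
  with r1(1) show "c \<in> space0"
    unfolding space0_def by blast
next
  fix c assume "c \<in> space0"
  then obtain r1 where r1: "0 < r1" "\<And>r2. 0 < r2 \<Longrightarrow> weight_bound \<theta> r2 r1 c"
    by (auto simp: space0_def)
  obtain r1' where r1': "0 < r1'" "dominated 2 r1 r1'"
    using ex_dominated_above[OF _ r1(1), of 2] by auto
  have "c \<in> ell p (omega s r2' r1')" if r2': "0 < r2'" for r2'
  proof -
    obtain r2 where r2: "0 < r2" "dominated 2 r2' r2"
      using ex_dominated_above[OF _ r2', of 2] by auto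
    show ?thesis
      by (rule ell_of_weight_bound[OF r1(2)[OF r2(1)] r1'(2) r2(2) r1(1) r2(1) r1'(1) r2' \<open>0 < p\<close>])
  qed
  with r1' show "c \<in> (\<Union>r1\<in>{0<..}. \<Inter>r2\<in>{0<..}. ell p (omega s r2 r1))" by auto
qed

lemma ell_C_eq_space1:
  assumes "0 < p"
    and below: "\<And>K r'. 1 \<le> K \<Longrightarrow> 0 < r' \<Longrightarrow> \<exists>r>0. dominated K r r'"
  shows "ell_C p s = space1"
proof (intro equalityI subsetI)
  fix c :: "(nat ^ 'd) \<times> (nat ^ 'd) \<Rightarrow> complex" assume "c \<in> ell_C p s"
  then obtain r2 where r2: "0 < r2" "\<And>r1. 0 < r1 \<Longrightarrow> c \<in> ell p (omega s r2 r1)"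
    by (auto simp: ell_C_def)
  then have "weight_bound \<theta> r2 r1 c" if "0 < r1" for r1
    using that weight_bound_of_ell \<open>0 < p\<close> by blast
  with r2(1) show "c \<in> space1"
    unfolding space1_def by blast
next
  fix c assume "c \<in> space1"
  then obtain r2 where r2: "0 < r2" "\<And>r1. 0 < r1 \<Longrightarrow> weight_bound \<theta> r2 r1 c"
    by (auto simp: space1_def)
  obtain r2' where r2': "0 < r2'" "dominated 2 r2' r2"
    using below[OF _ r2(1), of 2] by auto
  have "c \<in> ell p (omega s r2' r1')" if r1': "0 < r1'" for r1'
  proof -
    obtain r1 where r1: "0 < r1" "dominated 2 r1 r1'"
      using below[OF _ r1', of 2] by auto
    show ?thesis
      by (rule ell_of_weight_bound[OF r2(2)[OF r1(1)] r1(2) r2'(2) r1(1) r2(1) r1' r2'(1) \<open>0 < p\<close>])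
  qed
  with r2' show "c \<in> ell_C p s" by (auto simp: ell_C_def)
qed

end

end

section \<open>The concrete weights\<close>

text \<open>This is \<open>theta r (Reg s)\<close> for s > 0 and q = 1 / (2 s); the range s \<le>
  1/2 becomes q \<ge> 1.\<close>

definition reg_weight :: "real \<Rightarrow> real \<Rightarrow> nat ^ 'd::finite \<Rightarrow> real" where
  "reg_weight q r \<alpha> = exp (r * real (mlen \<alpha>) powr q)"

text \<open>This is \<open>theta r (Flat \<sigma>)\<close> for h = 1 / (2 \<sigma>).\<close>

definition flat_weight :: "real \<Rightarrow> real \<Rightarrow> nat ^ 'd::finite \<Rightarrow> real" where
  "flat_weight h r \<alpha> = r ^ mlen \<alpha> * mfact \<alpha> powr h"

lemma powr_add_le:
  fixes a b q :: real
  assumes "0 \<le> a" "0 \<le> b" "0 \<le> q"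
  shows "(a + b) powr q \<le> 2 powr q * (a powr q + b powr q)"
proof -
  have "(a + b) powr q \<le> (2 * max a b) powr q"
    using assms by (intro powr_mono2) auto
  also have "\<dots> = 2 powr q * max a b powr q"
    using assms by (simp add: powr_mult)
  also have "\<dots> \<le> 2 powr q * (a powr q + b powr q)"
    by (intro mult_left_mono) (auto simp: max_def)
  finally show ?thesis .
qed

text \<open>A natural number n satisfies n \<le> n^q for q \<ge> 1, so the exponent n ln K of the
  geometric factor is absorbed by adding ln K to the parameter.\<close>

lemma reg_weight_growth:
  assumes "1 \<le> q" "1 \<le> K"
  shows "K ^ mlen \<alpha> * reg_weight q r \<alpha> \<le> reg_weight q (r + ln K) \<alpha>"
proof -
  have "real (mlen \<alpha>) \<le> real (mlen \<alpha>) powr q"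
    using powr_mono[of 1 q "real (mlen \<alpha>)"] assms by (cases "mlen \<alpha> = 0") auto
  then have "ln K * real (mlen \<alpha>) \<le> ln K * real (mlen \<alpha>) powr q"
    using assms by (intro mult_left_mono) auto
  moreover have "K ^ mlen \<alpha> = exp (ln K * real (mlen \<alpha>))"
    using assms by (simp add: powr_realpow[symmetric] powr_def mult.commute)
  ultimately show ?thesis
    by (simp add: reg_weight_def exp_add[symmetric] distrib_right)
qed

lemma weight_family_reg:
  assumes q: "1 \<le> q"
  shows "weight_family (reg_weight q :: real \<Rightarrow> nat ^ 'd::finite \<Rightarrow> real) (2 powr q)"
proof
  have A: "2 \<le> (2::real) powr q" using powr_mono[of 1 q 2] q by simp
  then show "1 \<le> (2::real) powr q" by simp
  fix r r' :: real and \<alpha> \<gamma> :: "nat ^ 'd"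
  show "0 < reg_weight q r \<alpha>" by (simp add: reg_weight_def)
  show "reg_weight q r \<alpha> \<le> reg_weight q r' \<alpha>" if "r \<le> r'"
    using that by (simp add: reg_weight_def mult_right_mono)
  assume r: "0 < r"
  have "r * real (mlen (\<alpha> + \<gamma>)) powr q
      \<le> r * (2 powr q * (real (mlen \<alpha>) powr q + real (mlen \<gamma>) powr q))"
    using r q powr_add_le[of "real (mlen \<alpha>)" "real (mlen \<gamma>)" q]
    by (intro mult_left_mono) (auto simp: mlen_add)
  then show "reg_weight q r (\<alpha> + \<gamma>) \<le> reg_weight q (2 powr q * r) \<alpha> * reg_weight q (2 powr q * r) \<gamma>"
    by (simp add: reg_weight_def exp_add[symmetric] algebra_simps)
  define m where "m = real (mlen (\<alpha> + \<gamma>)) powr q"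
  have m: "real (mlen \<alpha>) powr q \<le> m" "real (mlen \<gamma>) powr q \<le> m" "0 \<le> m"
    unfolding m_def using q by (auto intro!: powr_mono2 simp: mlen_add)
  \<comment> \<open>Each of the two powers is at most m, and their number 2 is compensated by
    \<open>2 \<le> 2 powr q\<close>.\<close>
  have "r / 2 powr q * (real (mlen \<alpha>) powr q + real (mlen \<gamma>) powr q) \<le> r / 2 powr q * (2 * m)"
    using r m by (intro mult_left_mono) auto
  also have "\<dots> = (r * m) * (2 / 2 powr q)" by simp
  also have "\<dots> \<le> (r * m) * 1"
    using A r m by (intro mult_left_mono) auto
  finally show "reg_weight q (r / 2 powr q) \<alpha> * reg_weight q (r / 2 powr q) \<gamma> \<le> reg_weight q r (\<alpha> + \<gamma>)"
    by (simp add: reg_weight_def exp_add[symmetric] m_def distrib_left)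
next
  fix K r :: real assume "1 \<le> K" "0 < r"
  then show "\<exists>r'>0. \<exists>C>0. \<forall>\<alpha> :: nat ^ 'd. K ^ mlen \<alpha> * reg_weight q r \<alpha> \<le> C * reg_weight q r' \<alpha>"
    using reg_weight_growth[OF q, of K]
    by (intro exI[of _ "r + ln K"] conjI exI[of _ 1]) (auto intro: add_pos_nonneg)
qed

text \<open>For factorial weights the geometric factor merges with the power of r, so raising and
  lowering the parameter are both mere rescalings.\<close>

lemma flat_weight_growth:
  "K ^ mlen \<alpha> * flat_weight h r \<alpha> = flat_weight h (K * r) \<alpha>"
  by (simp add: flat_weight_def power_mult_distrib)

lemma mbinom_add_ge_1: "1 \<le> mbinom (\<alpha> + \<gamma>) \<gamma>"
  unfolding mbinom_def
proof (rule prod_ge_1)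
  fix j
  have "0 < ((\<alpha> + \<gamma>) $ j choose (\<gamma> $ j))" by simp
  then show "1 \<le> real ((\<alpha> + \<gamma>) $ j choose (\<gamma> $ j))" by linarith
qed

text \<open>The factorial of a sum exceeds the product of the factorials by a binomial between 1 and
  2^|\<alpha> + \<gamma>|; its h-th power is what A = 2^h compensates.\<close>

lemma weight_family_flat:
  assumes h: "0 < h"
  shows "weight_family (flat_weight h :: real \<Rightarrow> nat ^ 'd::finite \<Rightarrow> real) (2 powr h)"
proof
  have A: "1 \<le> (2::real) powr h" using h by (simp add: ge_one_powr_ge_zero)
  then show "1 \<le> (2::real) powr h" .
  fix r r' :: real and \<alpha> \<gamma> :: "nat ^ 'd"
  assume r: "0 < r"
  then show "0 < flat_weight h r \<alpha>" by (simp add: flat_weight_def)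
  show mono: "flat_weight h r \<alpha> \<le> flat_weight h r' \<alpha>" if "r \<le> r'"
    unfolding flat_weight_def using that r by (intro mult_right_mono power_mono) auto
  have fact: "mfact (\<alpha> + \<gamma>) powr h = mbinom (\<alpha> + \<gamma>) \<gamma> powr h * (mfact \<alpha> powr h * mfact \<gamma> powr h)"
    using mbinom_add_ge_1[of \<alpha> \<gamma>] mfact_pos[of \<alpha>] mfact_pos[of \<gamma>]
    by (simp add: mfact_add powr_mult)
  have prod: "flat_weight h x \<alpha> * flat_weight h x \<gamma>
      = x ^ mlen (\<alpha> + \<gamma>) * (mfact \<alpha> powr h * mfact \<gamma> powr h)" for x
    by (simp add: flat_weight_def mlen_add power_add)
  have "mbinom (\<alpha> + \<gamma>) \<gamma> powr h \<le> (2 ^ mlen (\<alpha> + \<gamma>)) powr h"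
    using mbinom_add_le[of \<alpha> \<gamma>] h by (intro powr_mono2) (auto simp: mlen_add mbinom_nonneg)
  also have "\<dots> = (2 powr h) ^ mlen (\<alpha> + \<gamma>)"
    by (simp add: power_powr_swap)
  finally have "flat_weight h r (\<alpha> + \<gamma>)
      \<le> r ^ mlen (\<alpha> + \<gamma>) * ((2 powr h) ^ mlen (\<alpha> + \<gamma>) * (mfact \<alpha> powr h * mfact \<gamma> powr h))"
    unfolding flat_weight_def fact using r by (intro mult_left_mono mult_right_mono) auto
  then show "flat_weight h r (\<alpha> + \<gamma>) \<le> flat_weight h (2 powr h * r) \<alpha> * flat_weight h (2 powr h * r) \<gamma>"
    by (simp add: prod power_mult_distrib mult_ac)
  have "flat_weight h (r / 2 powr h) \<alpha> * flat_weight h (r / 2 powr h) \<gamma>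
      \<le> r ^ mlen (\<alpha> + \<gamma>) * (mfact \<alpha> powr h * mfact \<gamma> powr h)"
    unfolding prod using r A by (intro mult_right_mono power_mono) (auto simp: field_simps)
  also have "\<dots> \<le> r ^ mlen (\<alpha> + \<gamma>) * mfact (\<alpha> + \<gamma>) powr h"
  proof -
    have "1 \<le> mbinom (\<alpha> + \<gamma>) \<gamma> powr h"
      using mbinom_add_ge_1[of \<alpha> \<gamma>] h by (simp add: ge_one_powr_ge_zero)
    then have "1 * (mfact \<alpha> powr h * mfact \<gamma> powr h) \<le> mfact (\<alpha> + \<gamma>) powr h"
      unfolding fact by (intro mult_right_mono) auto
    then show ?thesis using r by simp
  qed
  finally show "flat_weight h (r / 2 powr h) \<alpha> * flat_weight h (r / 2 powr h) \<gamma> \<le> flat_weight h r (\<alpha> + \<gamma>)"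
    by (simp add: flat_weight_def)
next
  fix K r :: real assume "1 \<le> K" "0 < r"
  then show "\<exists>r'>0. \<exists>C>0. \<forall>\<alpha> :: nat ^ 'd. K ^ mlen \<alpha> * flat_weight h r \<alpha> \<le> C * flat_weight h r' \<alpha>"
    by (intro exI[of _ "K * r"] conjI exI[of _ 1]) (auto simp: flat_weight_growth)
qed

section \<open>Lowering the parameter\<close>

lemma reg_weight_below:
  assumes q: "1 < q" and K: "1 \<le> K" and r: "0 < r'"
  shows "\<exists>r>0. weight_family.dominated (reg_weight q :: real \<Rightarrow> nat ^ 'd::finite \<Rightarrow> real) K r r'"
proof -
  \<comment> \<open>The threshold beyond which r'/2 times n^(q-1) exceeds ln K. It exists because q
    > 1, and half of the exponent then dominates the linear term; below it that term is bounded by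
    ln K times B.\<close>
  define B where "B = (2 * ln K / r') powr (1 / (q - 1))"
  have bound: "ln K * n - r' / 2 * n powr q \<le> ln K * B" if n: "0 \<le> n" for n
  proof (cases "n \<le> B")
    case True
    then have "ln K * n \<le> ln K * B" using K by (intro mult_left_mono) auto
    moreover have "0 \<le> r' / 2 * n powr q" using r by simp
    ultimately show ?thesis by linarith
  next
    case False
    have "0 \<le> B" by (simp add: B_def)
    with False have n0: "0 < n" by linarith
    have "B powr (q - 1) \<le> n powr (q - 1)"
      using False q \<open>0 \<le> B\<close> by (intro powr_mono2) auto
    then have "2 * ln K / r' \<le> n powr (q - 1)"
      using q K r by (simp add: B_def powr_powr)
    then have "ln K \<le> r' / 2 * n powr (q - 1)"
      using r by (simp add: field_simps)
    then have "ln K * n \<le> r' / 2 * n powr (q - 1) * n"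
      using n0 by (intro mult_right_mono) auto
    also have "\<dots> = r' / 2 * n powr q"
      using n0 powr_add[of n "q - 1" 1] by simp
    finally show ?thesis using K \<open>0 \<le> B\<close> by (smt (verit) ln_ge_zero mult_nonneg_nonneg)
  qed
  have "K ^ mlen \<alpha> * reg_weight q (r' / 2) \<alpha> \<le> exp (ln K * B) * reg_weight q r' \<alpha>" for \<alpha> :: "nat ^ 'd"
  proof -
    have "K ^ mlen \<alpha> = exp (ln K * real (mlen \<alpha>))"
      using K by (simp add: powr_realpow[symmetric] powr_def mult.commute)
    then show ?thesis
      using bound[of "real (mlen \<alpha>)"] by (simp add: reg_weight_def exp_add[symmetric])
  qed
  then show ?thesis
    using r q unfolding weight_family.dominated_def[OF weight_family_reg[OF less_imp_le[OF q]]]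
    by (intro exI[of _ "r' / 2"]) (auto intro!: exI[of _ "exp (ln K * B)"])
qed

lemma flat_weight_below:
  assumes h: "0 < h" and K: "1 \<le> K" and r: "0 < r'"
  shows "\<exists>r>0. weight_family.dominated (flat_weight h :: real \<Rightarrow> nat ^ 'd::finite \<Rightarrow> real) K r r'"
  using K r unfolding weight_family.dominated_def[OF weight_family_flat[OF h]]
  by (intro exI[of _ "r' / K"]) (auto simp: flat_weight_growth intro!: exI[of _ 1])

section \<open>The limit spaces\<close>

lemma less_Reg_half: "s < Reg (1 / 2) \<longleftrightarrow> (case s of Reg x \<Rightarrow> x < 1 / 2 | Flat \<sigma> \<Rightarrow> True)"
  by (cases s) (auto simp: less_rflat_def)

text \<open>For a given r1 only the indices with |\<beta>| \<le> r1 carry a nonzero weight, so the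
  intersection over r1 imposes nothing in \<beta>, while the infinite weight beyond r2 forces zeros
  in \<alpha>.\<close>

lemma ell_C_0:
  assumes "0 < p"
  shows "(ell_C p (Reg 0) :: ((nat ^ 'd::finite) \<times> (nat ^ 'd) \<Rightarrow> complex) set)
    = {c. \<exists>N. \<forall>\<alpha> \<beta>. N < mlen \<alpha> \<longrightarrow> c (\<alpha>, \<beta>) = 0}"
proof (intro equalityI subsetI)
  fix c :: "(nat ^ 'd) \<times> (nat ^ 'd) \<Rightarrow> complex"
  assume "c \<in> ell_C p (Reg 0)"
  then obtain r where r: "0 < r" "\<And>r1. 0 < r1 \<Longrightarrow> c \<in> ell p (omega (Reg 0) r r1)"
    by (auto simp: ell_C_def)
  have "c (\<alpha>, \<beta>) = 0" if \<alpha>: "nat \<lceil>r\<rceil> < mlen \<alpha>" for \<alpha> \<beta>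
  proof -
    \<comment> \<open>This parameter gives \<beta> the weight 1, so the infinite weight at \<alpha>
      is not divided away.\<close>
    have "c \<in> ell p (omega (Reg 0) r (real (mlen \<beta>) + 1))" by (rule r) simp
    then have "lp_norm p (\<lambda>i. ennreal (cmod (c i)) * omega (Reg 0) r (real (mlen \<beta>) + 1) i) < \<infinity>"
      by (simp add: ell_def)
    then obtain C where C: "\<And>i. ennreal (cmod (c i)) * omega (Reg 0) r (real (mlen \<beta>) + 1) i \<le> ennreal C"
      using assms by (rule lp_norm_finiteD) (rule that)
    have "ennreal (cmod (c (\<alpha>, \<beta>))) * omega (Reg 0) r (real (mlen \<beta>) + 1) (\<alpha>, \<beta>) \<le> ennreal C" by (rule C)
    moreover have "\<not> real (mlen \<alpha>) \<le> r" using \<alpha> by linarith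
    ultimately show ?thesis
      by (auto simp: omega_def divide_ennreal_def ennreal_mult_top top_unique ennreal_mult_eq_top_iff
          split: if_splits)
  qed
  then show "c \<in> {c. \<exists>N. \<forall>\<alpha> \<beta>. N < mlen \<alpha> \<longrightarrow> c (\<alpha>, \<beta>) = 0}" by auto
next
  fix c :: "(nat ^ 'd) \<times> (nat ^ 'd) \<Rightarrow> complex"
  assume "c \<in> {c. \<exists>N. \<forall>\<alpha> \<beta>. N < mlen \<alpha> \<longrightarrow> c (\<alpha>, \<beta>) = 0}"
  then obtain N where N: "\<And>\<alpha> \<beta>. N < mlen \<alpha> \<Longrightarrow> c (\<alpha>, \<beta>) = 0" by auto
  \<comment> \<open>N + 1 instead of N, since N may be 0 and the limits run over positive
    parameters.\<close>
  have "c \<in> ell p (omega (Reg 0) (real N + 1) r)" for r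
  proof -
    define S where "S = {\<alpha> :: nat ^ 'd. mlen \<alpha> \<le> N} \<times> {\<beta> :: nat ^ 'd. mlen \<beta> \<le> nat \<lfloor>r\<rfloor>}"
    have fin: "finite S" unfolding S_def by (intro finite_cartesian_product finite_mlen_le)
    define g where "g i = (if i \<in> S then cmod (c i) else 0)" for i
    have "lp_norm p (\<lambda>i. ennreal (cmod (c i)) * omega (Reg 0) (real N + 1) r i) < \<infinity>"
    proof (rule lp_norm_finiteI[where g = g and B = "sum g S"])
      fix i :: "(nat ^ 'd) \<times> (nat ^ 'd)"
      obtain \<alpha> \<beta> where i: "i = (\<alpha>, \<beta>)" by (cases i)
      consider "N < mlen \<alpha>" | "\<not> real (mlen \<beta>) \<le> r" | "mlen \<alpha> \<le> N" "real (mlen \<beta>) \<le> r" by linarith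
      then show "ennreal (cmod (c i)) * omega (Reg 0) (real N + 1) r i \<le> ennreal (g i)"
      proof cases
        case 3
        then have "i \<in> S" by (auto simp: S_def i le_nat_floor)
        with 3 show ?thesis by (simp add: i omega_def g_def divide_ennreal_def)
      qed (simp_all add: i N omega_def divide_ennreal_def)
      show "g i \<le> sum g S"
        using fin by (cases "i \<in> S") (auto simp: g_def intro!: member_le_sum sum_nonneg)
    next
      fix q :: real
      have "(\<lambda>i. g i powr q) summable_on S" by (rule summable_on_finite[OF fin])
      then show "(\<lambda>i. g i powr q) summable_on UNIV"
        by (rule summable_on_cong_neutral[THEN iffD1, rotated -1]) (auto simp: g_def)
    qed (auto simp: g_def assms)
    then show ?thesis by (simp add: ell_def)
  qed
  then show "c \<in> ell_C p (Reg 0)"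
    unfolding ell_C_def by (intro UN_I[of "real N + 1"]) auto
qed

text \<open>Shifting increases |\<alpha>|, so all the series are finite and the vanishing beyond N
  persists.\<close>

lemma shift_stable_ell_C_0:
  assumes "0 < p"
  shows "shift_stable (ell_C p (Reg 0) :: ((nat ^ 'd::finite) \<times> (nat ^ 'd) \<Rightarrow> complex) set)"
proof -
  let ?X = "{c :: (nat ^ 'd) \<times> (nat ^ 'd) \<Rightarrow> complex. \<exists>N. \<forall>\<alpha> \<beta>. N < mlen \<alpha> \<longrightarrow> c (\<alpha>, \<beta>) = 0}"
  have "module.subspace scale_series ?X"
  proof (subst module.subspace_def[OF module_scale_series], intro conjI ballI allI)
    fix c c' assume "c \<in> ?X" "c' \<in> ?X"
    then obtain N N' where "\<forall>\<alpha> \<beta>. N < mlen \<alpha> \<longrightarrow> c (\<alpha>, \<beta>) = 0" "\<forall>\<alpha> \<beta>. N' < mlen \<alpha> \<longrightarrow> c' (\<alpha>, \<beta>) = 0"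
      unfolding mem_Collect_eq by blast
    then show "c + c' \<in> ?X" by (auto intro!: exI[of _ "max N N'"])
  qed (auto simp: scale_series_def)
  moreover have "shift_summable c \<and> shift_exp t c \<in> ?X" if "c \<in> ?X" for c t
  proof -
    from that obtain N where N: "\<And>\<alpha> \<beta>. N < mlen \<alpha> \<Longrightarrow> c (\<alpha>, \<beta>) = 0" by auto
    have "shift_summable c"
      unfolding shift_summable_def
    proof (intro allI)
      fix \<alpha> \<beta> :: "nat ^ 'd"
      let ?f = "\<lambda>\<gamma>. 2 ^ mlen \<gamma> * shift_weight \<alpha> \<beta> \<gamma> * cmod (c (\<alpha> + \<gamma>, \<beta> + \<gamma>))"
      have "?f summable_on {\<gamma>. mlen \<gamma> \<le> N}" by (rule summable_on_finite[OF finite_mlen_le])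
      then show "?f summable_on UNIV"
        by (rule summable_on_cong_neutral[THEN iffD1, rotated -1]) (auto simp: N mlen_add)
    qed
    moreover have "shift_exp t c (\<alpha>, \<beta>) = 0" if "N < mlen \<alpha>" for \<alpha> \<beta>
      using that by (simp add: shift_exp_def N mlen_add)
    ultimately show ?thesis by auto
  qed
  ultimately show ?thesis
    unfolding ell_C_0[OF assms] shift_stable_def by blast
qed

lemma shift_stable_ell_C:
  assumes s: "s \<in> Rflat" "s < Reg (1 / 2)" and p: "0 < p"
  shows "shift_stable (ell_C p s :: ((nat ^ 'd::finite) \<times> (nat ^ 'd) \<Rightarrow> complex) set)"
proof (cases s)
  case (Reg x)
  show ?thesis
  proof (cases "x = 0")
    case True
    then show ?thesis using Reg shift_stable_ell_C_0[OF p] by simp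
  next
    case False
    then have x: "0 < x" "x < 1 / 2" using s Reg by (auto simp: Rflat_def less_Reg_half)
    define q where "q = 1 / (2 * x)"
    have q: "1 < q" using x by (simp add: q_def)
    interpret weight_family "reg_weight q :: real \<Rightarrow> nat ^ 'd \<Rightarrow> real" "2 powr q"
      using q by (intro weight_family_reg) simp
    have "ell_C p s = space1"
      by (rule ell_C_eq_space1) (use x p reg_weight_below[OF q] in \<open>auto simp: Reg q_def reg_weight_def\<close>)
    then show ?thesis using shift_stable_space1 reg_weight_below[OF q] by metis
  qed
next
  case (Flat \<sigma>)
  define h where "h = 1 / (2 * \<sigma>)"
  have h: "0 < h" using s Flat by (auto simp: h_def Rflat_def)
  interpret weight_family "flat_weight h :: real \<Rightarrow> nat ^ 'd \<Rightarrow> real" "2 powr h"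
    by (rule weight_family_flat[OF h])
  have "ell_C p s = space1"
    by (rule ell_C_eq_space1) (use p flat_weight_below[OF h] in \<open>auto simp: Flat h_def flat_weight_def\<close>)
  then show ?thesis using shift_stable_space1 flat_weight_below[OF h] by metis
qed

text \<open>The endpoint 1/2 corresponds to q = 1, which still gives a weight family, and
  \<open>space0\<close> asks for no lowering of parameters.\<close>

lemma shift_stable_ell_C0:
  assumes s: "s \<in> Rflat" "s \<le> Reg (1 / 2)" and p: "0 < p"
  shows "shift_stable (ell_C0 p s :: ((nat ^ 'd::finite) \<times> (nat ^ 'd) \<Rightarrow> complex) set)"
proof (cases "s = Reg 0")
  case True
  then show ?thesis
    by (simp add: ell_C0_def shift_stable_def module.subspace_single_0[OF module_scale_series]
        shift_summable_def shift_exp_def fun_eq_iff)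
next
  case False
  show ?thesis
  proof (cases s)
    case (Reg x)
    then have x: "0 < x" "x \<le> 1 / 2" using s False by (auto simp: Rflat_def)
    define q where "q = 1 / (2 * x)"
    have q: "1 \<le> q" using x by (simp add: q_def)
    interpret weight_family "reg_weight q :: real \<Rightarrow> nat ^ 'd \<Rightarrow> real" "2 powr q"
      by (rule weight_family_reg[OF q])
    have "(\<Union>r1\<in>{0<..}. \<Inter>r2\<in>{0<..}. ell p (omega s r2 r1)) = space0"
      by (rule ell_C0_eq_space0) (use x p in \<open>auto simp: Reg q_def reg_weight_def\<close>)
    then show ?thesis using shift_stable_space0 False by (simp add: ell_C0_def)
  next
    case (Flat \<sigma>)
    define h where "h = 1 / (2 * \<sigma>)"
    have h: "0 < h" using s Flat by (auto simp: h_def Rflat_def)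
    interpret weight_family "flat_weight h :: real \<Rightarrow> nat ^ 'd \<Rightarrow> real" "2 powr h"
      by (rule weight_family_flat[OF h])
    have "(\<Union>r1\<in>{0<..}. \<Inter>r2\<in>{0<..}. ell p (omega s r2 r1)) = space0"
      by (rule ell_C0_eq_space0) (use p in \<open>auto simp: Flat h_def flat_weight_def\<close>)
    then show ?thesis using shift_stable_space0 False by (simp add: ell_C0_def)
  qed
qed

theorem theorem4p9:
  fixes s1 s2 :: rflat and p :: ennreal
  assumes "s1 \<in> Rflat" and "s2 \<in> Rflat"
    and "s1 < Reg (1/2)" and "s2 \<le> Reg (1/2)"
    and "0 < p"
  shows "linear_bijection scale_series scale_op
           (C_hat p s1 :: 'd::finite series2 set) (Op_wick ` C_hat p s1) Op_antiwick \<and>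
         linear_bijection scale_series scale_op
           (C_hat_star p s1 :: 'd series2 set) (Op_wick ` C_hat_star p s1) Op_antiwick \<and>
         linear_bijection scale_series scale_op
           (C0_hat p s2 :: 'd series2 set) (Op_wick ` C0_hat p s2) Op_antiwick \<and>
         linear_bijection scale_series scale_op
           (C0_hat_star p s2 :: 'd series2 set) (Op_wick ` C0_hat_star p s2) Op_antiwick"
  unfolding C_hat_def C_hat_star_def C0_hat_def C0_hat_star_def ell_C_star_swap ell_C0_star_swap
  using shift_stable_ell_C[OF assms(1,3,5)] shift_stable_ell_C0[OF assms(2,4,5)]
  by (intro conjI linear_bijection_Op_antiwick shift_stable_swap) auto

end
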